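(* There is a polynomial-time many-one reduction from Bounded Quartic Equality Feasibility (BQ4E) to Homogeneous Quadratic Sphere Feasibility (HQSF).
   Context: BQ4E: given a polynomial $h\in\mathbb{Q}[x_1,\dots,x_n]$ of total degree at most $4$, decide whether there exists $x\in[-1,1]^n$ with $h(x)=0$. HQSF: given homogeneous quadratic forms $q_1,\dots,q_m\in\mathbb{Q}[y_1,\dots,y_N]$, decide whether there exists $y\in\mathbb{R}^N$ with $\|y\|^2=1$ and $q_j(y)=0$ for all $j=1,\dots,m$ ($\|\cdot\|$ the Euclidean norm). A polynomial-time many-one reduction from $A$ to $B$ maps each instance of $A$ (with rational data) in time polynomial in its size to an instance of $B$ with the same YES/NO answer. *)

theory Defs
  imports "HOL-Analysis.L2_Norm" "HOL-Library.Poly_Mapping"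
begin

text \<open>A monomial is its exponent function, a polynomial its coefficient function. Variables are
  numbered from \<open>0\<close>, so the ring in \<open>n\<close> variables uses the variables \<open>i < n\<close>.\<close>

type_synonym monom = "nat \<Rightarrow>\<^sub>0 nat"
type_synonym ratpoly = "monom \<Rightarrow>\<^sub>0 rat"

definition in_vars :: "nat \<Rightarrow> ratpoly \<Rightarrow> bool" where
  "in_vars n h \<longleftrightarrow> (\<forall>m \<in> Poly_Mapping.keys h. Poly_Mapping.keys m \<subseteq> {..<n})"

definition monom_degree :: "monom \<Rightarrow> nat" where
  "monom_degree m = (\<Sum>i \<in> Poly_Mapping.keys m. Poly_Mapping.lookup m i)"

definition total_degree :: "ratpoly \<Rightarrow> nat" where
  "total_degree h = Max (insert 0 (monom_degree ` Poly_Mapping.keys h))"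

definition quadratic_form :: "ratpoly \<Rightarrow> bool" where
  "quadratic_form q \<longleftrightarrow> (\<forall>m \<in> Poly_Mapping.keys q. monom_degree m = 2)"

definition poly_eval :: "ratpoly \<Rightarrow> (nat \<Rightarrow> real) \<Rightarrow> real" where
  "poly_eval h x = (\<Sum>m \<in> Poly_Mapping.keys h.
     of_rat (Poly_Mapping.lookup h m) *
     (\<Prod>i \<in> Poly_Mapping.keys m. x i ^ Poly_Mapping.lookup m i))"

text \<open>Tape symbols are the numbers below \<open>symbols M\<close>: \<open>0\<close> is the blank, \<open>1\<close> and \<open>2\<close> stand for the
  bits \<open>False\<close> and \<open>True\<close>. The states are \<open>0, \<dots>, states M\<close>, where \<open>0\<close> is the start state and
  \<open>states M\<close> is the halting state. Tapes are infinite in both directions; a tape is given by its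
  contents and its head position.\<close>

datatype dir = Go_Left | Stay | Go_Right

record tm =
  tapes :: nat
  symbols :: nat
  states :: nat
  delta :: "nat \<Rightarrow> nat list \<Rightarrow> nat \<times> (nat \<times> dir) list"

definition tm_wf :: "tm \<Rightarrow> bool" where
  "tm_wf M \<longleftrightarrow> 1 \<le> tapes M \<and> 3 \<le> symbols M \<and>
     (\<forall>q < states M. \<forall>as. length as = tapes M \<and> set as \<subseteq> {..<symbols M} \<longrightarrow>
        (case delta M q as of (q', acts) \<Rightarrow>
           q' \<le> states M \<and> length acts = tapes M \<and> fst ` set acts \<subseteq> {..<symbols M}))"

type_synonym tape = "(int \<Rightarrow> nat) \<times> int"
type_synonym config = "nat \<times> tape list"

fun head_symbol :: "tape \<Rightarrow> nat" where
  "head_symbol (f, p) = f p"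

fun shift :: "dir \<Rightarrow> int" where
  "shift Go_Left = -1"
| "shift Stay = 0"
| "shift Go_Right = 1"

fun act :: "nat \<times> dir \<Rightarrow> tape \<Rightarrow> tape" where
  "act (a, d) (f, p) = (f(p := a), p + shift d)"

fun tm_step :: "tm \<Rightarrow> config \<Rightarrow> config" where
  "tm_step M (q, ts) =
     (if q < states M
      then (case delta M q (map head_symbol ts) of (q', acts) \<Rightarrow> (q', map2 act acts ts))
      else (q, ts))"

definition word_tape :: "int \<Rightarrow> bool list \<Rightarrow> tape" where
  "word_tape p w =
     (\<lambda>i. if p \<le> i \<and> i < p + int (length w) then (if w ! nat (i - p) then 2 else 1) else 0, p)"

definition tm_init :: "tm \<Rightarrow> bool list \<Rightarrow> config" where
  "tm_init M w = (0, word_tape 0 w # replicate (tapes M - 1) (word_tape 0 []))"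

text \<open>The first tape serves for input and output; on halting, its head stands on the first symbol
  of the output word, wherever that is.\<close>

definition tm_computes_within :: "tm \<Rightarrow> bool list \<Rightarrow> bool list \<Rightarrow> nat \<Rightarrow> bool" where
  "tm_computes_within M w w' t \<longleftrightarrow>
     (\<exists>t' \<le> t. \<exists>p ts. (tm_step M ^^ t') (tm_init M w) = (states M, word_tape p w' # ts))"

definition polytime_computable_on :: "bool list set \<Rightarrow> (bool list \<Rightarrow> bool list) \<Rightarrow> bool" where
  "polytime_computable_on D f \<longleftrightarrow>
     (\<exists>M c d. tm_wf M \<and> (\<forall>w \<in> D. tm_computes_within M w (f w) (c * length w ^ d + c)))"

text \<open>An instance may have several encodings, for example because the terms of a polynomial may be
  listed in any order; the size of an encoded instance is the length of the word.\<close>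

record 'i decision_problem =
  instances :: "'i set"
  yes_instances :: "'i set"
  encodes :: "bool list \<Rightarrow> 'i \<Rightarrow> bool"

definition polytime_reducible :: "'i decision_problem \<Rightarrow> 'j decision_problem \<Rightarrow> bool" where
  "polytime_reducible A B \<longleftrightarrow>
     (\<exists>f. polytime_computable_on {w. \<exists>I \<in> instances A. encodes A w I} f \<and>
        (\<forall>I \<in> instances A. \<forall>w. encodes A w I \<longrightarrow>
           (\<exists>J \<in> instances B. encodes B (f w) J \<and>
              (I \<in> yes_instances A \<longleftrightarrow> J \<in> yes_instances B))))"

text \<open>All encodings are self-delimiting, so that they can be concatenated.\<close>

definition enc_list :: "('a \<Rightarrow> bool list) \<Rightarrow> 'a list \<Rightarrow> bool list" where
  "enc_list e xs = concat (map (\<lambda>x. True # e x) xs) @ [False]"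

definition enc_unary :: "nat \<Rightarrow> bool list" where
  "enc_unary n = replicate n True @ [False]"

text \<open>Binary digits, least significant first.\<close>

fun nat_bits :: "nat \<Rightarrow> bool list" where
  "nat_bits n = (if n = 0 then [] else odd n # nat_bits (n div 2))"

declare nat_bits.simps [simp del]

definition enc_nat :: "nat \<Rightarrow> bool list" where
  "enc_nat n = enc_list (\<lambda>b. [b]) (nat_bits n)"

definition enc_int :: "int \<Rightarrow> bool list" where
  "enc_int k = (k < 0) # enc_nat (nat \<bar>k\<bar>)"

definition enc_rat :: "rat \<Rightarrow> bool list" where
  "enc_rat r = (case quotient_of r of (a, b) \<Rightarrow> enc_int a @ enc_int b)"

text \<open>A term is given by its coefficient and the list of its variables, repeated according to
  multiplicity and in any order: \<open>[i, i, j]\<close> stands for the monomial \<open>x\<^sub>i\<^sup>2 x\<^sub>j\<close>. The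
  number of variables is part of the size of an instance, so it is written in unary, and so
  are the indices of variables; a coefficient is written in binary as a reduced fraction.\<close>

type_synonym terms = "(nat list \<times> rat) list"

definition enc_terms :: "terms \<Rightarrow> bool list" where
  "enc_terms = enc_list (\<lambda>(vs, c). enc_list enc_unary vs @ enc_rat c)"

definition monom_of :: "nat list \<Rightarrow> monom" where
  "monom_of vs = (\<Sum>i \<leftarrow> vs. Poly_Mapping.single i 1)"

text \<open>The list contains exactly the terms with nonzero coefficient, each once.\<close>

definition lists_terms :: "terms \<Rightarrow> ratpoly \<Rightarrow> bool" where
  "lists_terms ts h \<longleftrightarrow>
     distinct (map (\<lambda>(vs, c). monom_of vs) ts) \<and>
     (\<lambda>(vs, c). (monom_of vs, c)) ` set ts =
       (\<lambda>m. (m, Poly_Mapping.lookup h m)) ` Poly_Mapping.keys h"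

definition BQ4E :: "(nat \<times> ratpoly) decision_problem" where
  "BQ4E = \<lparr>
     instances = {(n, h). in_vars n h \<and> total_degree h \<le> 4},
     yes_instances = {(n, h). \<exists>x. (\<forall>i < n. x i \<in> {-1..1}) \<and> poly_eval h x = 0},
     encodes = (\<lambda>w (n, h). \<exists>ts. lists_terms ts h \<and> w = enc_unary n @ enc_terms ts)\<rparr>"

definition HQSF :: "(nat \<times> ratpoly list) decision_problem" where
  "HQSF = \<lparr>
     instances = {(N, qs). \<forall>q \<in> set qs. in_vars N q \<and> quadratic_form q},
     yes_instances =
       {(N, qs). \<exists>y. (L2_set y {..<N})\<^sup>2 = 1 \<and> (\<forall>q \<in> set qs. poly_eval q y = 0)},
     encodes = (\<lambda>w (N, qs). \<exists>tss. list_all2 lists_terms tss qs \<and>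
        w = enc_unary N @ enc_list enc_terms tss)\<rparr>"

definition self_delimiting :: "('a \<Rightarrow> bool list) \<Rightarrow> bool" where
  "self_delimiting e \<longleftrightarrow> (\<forall>x y u v. e x @ u = e y @ v \<longrightarrow> x = y \<and> u = v)"

lemma self_delimitingD:
  "self_delimiting e \<Longrightarrow> e x @ u = e y @ v \<Longrightarrow> x = y \<and> u = v"
  by (auto simp: self_delimiting_def)

lemma self_delimiting_list:
  assumes "self_delimiting e"
  shows "self_delimiting (enc_list e)"
proof -
  have "xs = ys \<and> u = v" if "enc_list e xs @ u = enc_list e ys @ v" for xs ys u v
    using that
  proof (induction xs arbitrary: ys)
    case Nil
    then show ?case by (cases ys) (auto simp: enc_list_def)
  next
    case (Cons x xs)
    then obtain y ys' where ys: "ys = y # ys'"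
      by (cases ys) (auto simp: enc_list_def)
    have "e x @ (enc_list e xs @ u) = e y @ (enc_list e ys' @ v)"
      using Cons.prems by (simp add: ys enc_list_def)
    then show ?case
      using self_delimitingD [OF assms] Cons.IH ys by blast
  qed
  then show ?thesis unfolding self_delimiting_def by blast
qed

lemma self_delimiting_unary: "self_delimiting enc_unary"
proof -
  have "m = n \<and> u = v" if "enc_unary m @ u = enc_unary n @ v" for m n u v
    using that
  proof (induction m arbitrary: n)
    case 0
    then show ?case by (cases n) (auto simp: enc_unary_def)
  next
    case (Suc m)
    then show ?case by (cases n) (auto simp: enc_unary_def)
  qed
  then show ?thesis unfolding self_delimiting_def by blast
qed

lemma nat_bits_0: "nat_bits 0 = []"
  by (subst nat_bits.simps) simp

lemma nat_bits_pos: "n \<noteq> 0 \<Longrightarrow> nat_bits n = odd n # nat_bits (n div 2)"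
  by (subst nat_bits.simps) simp

lemma nat_bits_inj: "nat_bits m = nat_bits n \<Longrightarrow> m = n"
proof (induction m arbitrary: n rule: less_induct)
  case (less m)
  show ?case
  proof (cases "m = 0 \<or> n = 0")
    case True
    then show ?thesis
      using less.prems nat_bits_0 nat_bits_pos by (metis list.distinct(1))
  next
    case False
    then have eq: "odd m = odd n" "nat_bits (m div 2) = nat_bits (n div 2)"
      using less.prems nat_bits_pos [of m] nat_bits_pos [of n] by (metis list.inject)+
    have "m div 2 < m" using False by simp
    from less.IH [OF this eq(2)] have "m div 2 = n div 2" .
    then show ?thesis using eq(1) by presburger
  qed
qed

lemma self_delimiting_nat: "self_delimiting enc_nat"
proof -
  have "self_delimiting (enc_list (\<lambda>b::bool. [b]))"
    by (rule self_delimiting_list) (simp add: self_delimiting_def)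
  then show ?thesis
    unfolding self_delimiting_def enc_nat_def using nat_bits_inj by blast
qed

lemma self_delimiting_int: "self_delimiting enc_int"
proof -
  have "j = k \<and> u = v" if "enc_int j @ u = enc_int k @ v" for j k u v
  proof -
    have "(j < 0) = (k < 0)" "enc_nat (nat \<bar>j\<bar>) @ u = enc_nat (nat \<bar>k\<bar>) @ v"
      using that by (auto simp: enc_int_def)
    moreover from this(2) have "nat \<bar>j\<bar> = nat \<bar>k\<bar>" "u = v"
      using self_delimitingD [OF self_delimiting_nat] by blast+
    ultimately show ?thesis by linarith
  qed
  then show ?thesis unfolding self_delimiting_def by blast
qed

lemma self_delimiting_rat: "self_delimiting enc_rat"
proof -
  have "r = s \<and> u = v" if "enc_rat r @ u = enc_rat s @ v" for r s u v
  proof -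
    obtain a b c d where q: "quotient_of r = (a, b)" "quotient_of s = (c, d)"
      by (metis surj_pair)
    with that have "enc_int a @ (enc_int b @ u) = enc_int c @ (enc_int d @ v)"
      by (simp add: enc_rat_def)
    then have "a = c" "b = d" "u = v"
      using self_delimitingD [OF self_delimiting_int] by blast+
    with q show ?thesis by (metis quotient_of_inject)
  qed
  then show ?thesis unfolding self_delimiting_def by blast
qed

lemma self_delimiting_terms: "self_delimiting enc_terms"
proof -
  have "vs = vs' \<and> c = c' \<and> u = v"
    if "enc_list enc_unary vs @ enc_rat c @ u = enc_list enc_unary vs' @ enc_rat c' @ v"
    for vs vs' c c' u v
    using self_delimitingD [OF self_delimiting_list [OF self_delimiting_unary] that]
      self_delimitingD [OF self_delimiting_rat] by blast
  then have "self_delimiting (\<lambda>(vs, c). enc_list enc_unary vs @ enc_rat c)"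
    unfolding self_delimiting_def split_paired_All prod.case append_assoc prod.inject by blast
  then show ?thesis
    unfolding enc_terms_def by (rule self_delimiting_list)
qed

lemma lists_terms_unique:
  assumes "lists_terms ts g" "lists_terms ts h"
  shows "g = h"
proof (rule poly_mapping_eqI)
  fix m
  have eq: "(\<lambda>m. (m, Poly_Mapping.lookup g m)) ` Poly_Mapping.keys g =
        (\<lambda>m. (m, Poly_Mapping.lookup h m)) ` Poly_Mapping.keys h"
    using assms by (simp add: lists_terms_def)
  show "Poly_Mapping.lookup g m = Poly_Mapping.lookup h m"
  proof (cases "m \<in> Poly_Mapping.keys g \<or> m \<in> Poly_Mapping.keys h")
    case True
    then show ?thesis using eq by (auto simp: set_eq_iff image_iff)
  next
    case False
    then show ?thesis by (simp add: in_keys_iff)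
  qed
qed

lemma monom_of_surj: "\<exists>vs. monom_of vs = m"
proof (induction m rule: update_induct)
  case const
  have "monom_of [] = 0" by (simp add: monom_of_def)
  then show ?case by blast
next
  case (update f k v)
  then obtain vs where "monom_of vs = f" by blast
  moreover have "monom_of (replicate v k) = Poly_Mapping.single k v"
    by (induction v) (simp_all add: monom_of_def flip: single_add)
  moreover have "Poly_Mapping.update k v f = Poly_Mapping.single k v + f"
    using update.hyps(1)
    by (intro poly_mapping_eqI)
      (auto simp: update.rep_eq lookup_add lookup_single in_keys_iff when_def)
  ultimately have "monom_of (replicate v k @ vs) = Poly_Mapping.update k v f"
    by (simp add: monom_of_def)
  then show ?case by blast
qed

lemma lists_terms_exists: "\<exists>ts. lists_terms ts h"
proof -
  obtain ms where ms: "set ms = Poly_Mapping.keys h" "distinct ms"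
    using finite_distinct_list [OF finite_keys [of h]] by blast
  obtain vs where vs: "\<And>m. monom_of (vs m) = m" using monom_of_surj by metis
  have "lists_terms (map (\<lambda>m. (vs m, Poly_Mapping.lookup h m)) ms) h"
    using ms by (simp add: lists_terms_def vs comp_def image_image)
  then show ?thesis by blast
qed

lemma BQ4E_encoding_exists: "\<exists>w. encodes BQ4E w I"
  using lists_terms_exists by (cases I) (auto simp: BQ4E_def)

lemma BQ4E_encoding_unambiguous:
  assumes "encodes BQ4E w I" "encodes BQ4E w J"
  shows "I = J"
proof -
  obtain n g m h where IJ: "I = (n, g)" "J = (m, h)" by (metis surj_pair)
  obtain ts us where ts: "lists_terms ts g" "w = enc_unary n @ enc_terms ts"
    and us: "lists_terms us h" "w = enc_unary m @ enc_terms us"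
    using assms by (auto simp: BQ4E_def IJ)
  then have "n = m" "enc_terms ts = enc_terms us"
    using self_delimitingD [OF self_delimiting_unary] by metis+
  moreover from this(2) have "ts = us"
    using self_delimitingD [OF self_delimiting_terms, of ts "[]" us "[]"] by simp
  ultimately show ?thesis using ts us lists_terms_unique IJ by blast
qed

lemma HQSF_encoding_exists: "\<exists>w. encodes HQSF w J"
proof -
  obtain N qs where J: "J = (N, qs)" by (metis surj_pair)
  have "\<exists>tss. list_all2 lists_terms tss qs"
    by (induction qs) (auto simp: list_all2_Cons2 lists_terms_exists)
  then show ?thesis by (auto simp: HQSF_def J)
qed

lemma HQSF_encoding_unambiguous:
  assumes "encodes HQSF w I" "encodes HQSF w J"
  shows "I = J"
proof -
  obtain n gs m hs where IJ: "I = (n, gs)" "J = (m, hs)" by (metis surj_pair)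
  obtain ts us where ts: "list_all2 lists_terms ts gs" "w = enc_unary n @ enc_list enc_terms ts"
    and us: "list_all2 lists_terms us hs" "w = enc_unary m @ enc_list enc_terms us"
    using assms by (auto simp: HQSF_def IJ)
  then have "n = m" "enc_list enc_terms ts = enc_list enc_terms us"
    using self_delimitingD [OF self_delimiting_unary] by metis+
  moreover from this(2) have tu: "ts = us"
    using self_delimitingD [OF self_delimiting_list [OF self_delimiting_terms], of ts "[]" us "[]"]
    by simp
  moreover have "gs = hs"
  proof (rule nth_equalityI)
    show "length gs = length hs"
      using ts(1) us(1) tu by (simp add: list_all2_conv_all_nth)
    show "gs ! i = hs ! i" if "i < length gs" for i
    proof (rule lists_terms_unique)
      show "lists_terms (us ! i) (gs ! i)" "lists_terms (us ! i) (hs ! i)"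
        using that ts(1) us(1) tu by (simp_all add: list_all2_conv_all_nth)
    qed
  qed
  ultimately show ?thesis using IJ by blast
qed

end

theory Submission
  imports Defs "HOL-Library.Multiset"
begin

text \<open>Homogenize with a variable \<open>t\<close>. Every occurrence of a variable \<open>x\<^sub>v\<close> in a term gets a new
  variable for the partial product up to it, tied to the previous one by \<open>t z' = z x\<^sub>v\<close>; then the
  quartic equation becomes \<open>\<Sum>\<^sub>k c\<^sub>k t z\<^sub>k = 0\<close>, with \<open>z\<^sub>k\<close> the full product of term \<open>k\<close>. Each \<open>x\<close>
  and each \<open>z\<close> has a slack variable \<open>s\<close> with \<open>z\<^sup>2 + s\<^sup>2 = t\<^sup>2\<close>. This expresses \<open>x \<in> [-1, 1]\<close> and
  also forces \<open>t \<noteq> 0\<close> on the sphere, since \<open>t = 0\<close> would make all variables vanish. As the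
  partial products of different terms are never shared, no like terms have to be collected, and
  the forms are written down in one pass over the input. This pass is programmed with stacks of
  bits, each of which is a tape of the Turing machine.\<close>

section \<open>Stack programs as Turing machines\<close>

text \<open>A tape of the form \<open>word_tape p w\<close> is a stack of bits with its top under the head.
  Pushing takes two steps, \<open>Move_Left\<close> and then \<open>Put\<close>. \<open>Branch i A d\<close> goes on to the next
  instruction if stack \<open>i\<close> is nonempty and its top is in \<open>A\<close>, and otherwise jumps by the
  relative distance \<open>d\<close>, so that code can be placed anywhere in a larger program.\<close>

definition num_stacks :: nat where
  "num_stacks = 6"

datatype instr = Move_Left nat | Put nat bool | Del nat | Branch nat "bool set" int

definition bit_symbol :: "bool \<Rightarrow> nat" where
  "bit_symbol b = (if b then 2 else 1)"

fun jump :: "instr \<Rightarrow> nat list \<Rightarrow> int" where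
  "jump (Branch i A d) as = (if as ! i \<in> bit_symbol ` A then 1 else d)"
| "jump _ as = 1"

fun action :: "instr \<Rightarrow> nat \<Rightarrow> nat \<Rightarrow> nat \<times> dir" where
  "action (Move_Left i) j a = (a, if j = i then Go_Left else Stay)"
| "action (Put i b) j a = (if j = i then bit_symbol b else a, Stay)"
| "action (Del i) j a = (if j = i then (0, Go_Right) else (a, Stay))"
| "action (Branch i A d) j a = (a, Stay)"

text \<open>The minimum keeps the machine well-formed even for code with wild jumps.\<close>

definition machine :: "instr list \<Rightarrow> tm" where
  "machine code = \<lparr>tapes = num_stacks, symbols = 3, states = length code,
     delta = (\<lambda>q as. (min (length code) (nat (int q + jump (code ! q) as)),
                      map (\<lambda>j. action (code ! q) j (as ! j)) [0..<num_stacks]))\<rparr>"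

lemma fst_action_less: "a < 3 \<Longrightarrow> fst (action ins j a) < 3"
  by (cases ins) (auto simp: bit_symbol_def)

lemma tm_wf_machine: "tm_wf (machine code)"
proof -
  have less: "as ! j < 3"
    if "length as = num_stacks" "set as \<subseteq> {..<3}" "j < num_stacks" for as :: "nat list" and j
    using that nth_mem[of j as] by (metis lessThan_iff subsetD)
  have "1 \<le> num_stacks"
    by (simp add: num_stacks_def)
  then show ?thesis
    by (auto simp: tm_wf_def machine_def intro!: fst_action_less less)
qed

text \<open>Head positions are left open, since pushing and popping shift them; the output
  convention of the machine model allows any position too.\<close>

definition holds_stacks :: "tape list \<Rightarrow> (nat \<Rightarrow> bool list) \<Rightarrow> bool" where
  "holds_stacks ts s \<longleftrightarrow> length ts = num_stacks \<and> (\<forall>j < num_stacks. \<exists>p. ts ! j = word_tape p (s j))"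

definition top_in :: "bool list \<Rightarrow> bool set \<Rightarrow> bool" where
  "top_in w A \<longleftrightarrow> w \<noteq> [] \<and> hd w \<in> A"

lemma top_in_simps [simp]: "\<not> top_in [] A" "top_in (b # w) A \<longleftrightarrow> b \<in> A"
  by (auto simp: top_in_def)

lemma head_symbol_word_tape:
  "head_symbol (word_tape p w) = (if w = [] then 0 else bit_symbol (hd w))"
  by (cases w) (auto simp: word_tape_def bit_symbol_def)

lemma head_symbol_top_in: "head_symbol (word_tape p w) \<in> bit_symbol ` A \<longleftrightarrow> top_in w A"
  by (cases w) (auto simp: head_symbol_word_tape bit_symbol_def image_iff split: if_splits)

lemma act_keep [simp]: "act (head_symbol t, Stay) t = t"
  by (cases t) auto

text \<open>The first action puts the head on the blank left of the word, the second overwrites that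
  blank. In between, a nonempty stack is not of the form \<open>word_tape p w\<close>, so the two
  instructions are only specified together.\<close>

lemma act_push:
  "act (bit_symbol b, Stay) (act (head_symbol (word_tape p w), Go_Left) (word_tape p w)) =
     word_tape (p - 1) (b # w)"
proof -
  have "nat (i - (p - 1)) = Suc (nat (i - p))" if "p \<le> i" for i
    using that by linarith
  then show ?thesis
    by (auto simp: word_tape_def bit_symbol_def fun_eq_iff)
qed

lemma act_pop: "act (0, Go_Right) (word_tape p (b # w)) = word_tape (p + 1) w"
proof -
  have "nat (i - p) = Suc (nat (i - (p + 1)))" if "p + 1 \<le> i" for i
    using that by linarith
  then show ?thesis
    by (auto simp: word_tape_def fun_eq_iff)
qed

lemma tm_step_machine:
  assumes "q < length code" "length ts = num_stacks"
  shows "tm_step (machine code) (q, ts) =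
    (min (length code) (nat (int q + jump (code ! q) (map head_symbol ts))),
     map (\<lambda>j. act (action (code ! q) j (head_symbol (ts ! j))) (ts ! j)) [0..<num_stacks])"
  using assms by (auto simp: machine_def intro!: nth_equalityI)

text \<open>The bound on the growth of the stacks comes for free here; it makes the sizes of
  intermediate results follow from the running times.\<close>

definition runs :: "instr list \<Rightarrow> (nat \<Rightarrow> bool list) \<Rightarrow> nat \<Rightarrow> (nat \<Rightarrow> bool list) \<Rightarrow> bool" where
  "runs c s t s' \<longleftrightarrow>
     (\<forall>j. length (s' j) \<le> length (s j) + t) \<and>
     (\<forall>pre post ts. holds_stacks ts s \<longrightarrow>
        (\<exists>t' \<le> t. \<exists>ts'. holds_stacks ts' s' \<and>
           (tm_step (machine (pre @ c @ post)) ^^ t') (length pre, ts) =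
             (length pre + length c, ts')))"

lemma runsI:
  assumes "\<And>j. length (s' j) \<le> length (s j) + t"
    and "\<And>pre post ts. holds_stacks ts s \<Longrightarrow>
        (\<exists>t' \<le> t. \<exists>ts'. holds_stacks ts' s' \<and>
           (tm_step (machine (pre @ c @ post)) ^^ t') (length pre, ts) =
             (length pre + length c, ts'))"
  shows "runs c s t s'"
  using assms by (auto simp: runs_def)

lemma runs_stepsE:
  assumes "runs c s t s'" "holds_stacks ts s" "code = pre @ c @ post" "q = length pre"
  obtains t' ts' where "t' \<le> t" "holds_stacks ts' s'"
    "(tm_step (machine code) ^^ t') (q, ts) = (q + length c, ts')"
  using assms unfolding runs_def by blast

lemma runs_length: "runs c s t s' \<Longrightarrow> length (s' j) \<le> length (s j) + t"
  by (auto simp: runs_def)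

lemma runs_mono: "runs c s t s' \<Longrightarrow> t \<le> u \<Longrightarrow> runs c s u s'"
  unfolding runs_def by (meson add_left_mono le_trans)

lemma runs_Nil: "runs [] s 0 s"
  by (auto simp: runs_def intro!: exI[of _ "0::nat"])

lemma funpow_trans:
  assumes "(f ^^ m) x = y" "(f ^^ n) y = z"
  shows "(f ^^ (m + n)) x = z"
  using assms by (metis add.commute funpow_add o_apply)

text \<open>\<open>runs\<close> quantifies over the surrounding code: \<open>c'\<close> becomes part
  of the code after \<open>c\<close>, and \<open>c\<close> part of the code before
  \<open>c'\<close>.\<close>

lemma runs_append:
  assumes 1: "runs c s t s'" and 2: "runs c' s' t' s''"
  shows "runs (c @ c') s (t + t') s''"
proof (rule runsI)
  show "length (s'' j) \<le> length (s j) + (t + t')" for j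
    using runs_length[OF 1, of j] runs_length[OF 2, of j] by simp
  fix pre post ts
  assume "holds_stacks ts s"
  from runs_stepsE[OF 1 this, of "pre @ (c @ c') @ post" pre "c' @ post" "length pre"]
  obtain u ts' where u: "u \<le> t" "holds_stacks ts' s'"
    "(tm_step (machine (pre @ (c @ c') @ post)) ^^ u) (length pre, ts) =
       (length pre + length c, ts')" by auto
  from runs_stepsE[OF 2 u(2), of "pre @ (c @ c') @ post" "pre @ c" post "length pre + length c"]
  obtain u' ts'' where u': "u' \<le> t'" "holds_stacks ts'' s''"
    "(tm_step (machine (pre @ (c @ c') @ post)) ^^ u') (length pre + length c, ts') =
       (length pre + length (c @ c'), ts'')" by (auto simp: add.assoc)
  show "\<exists>v \<le> t + t'. \<exists>ts'. holds_stacks ts' s'' \<and>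
      (tm_step (machine (pre @ (c @ c') @ post)) ^^ v) (length pre, ts) =
        (length pre + length (c @ c'), ts')"
    using funpow_trans[OF u(3) u'(3)] u(1) u'(1,2) by (meson add_mono)
qed

section \<open>Structured control flow and its running time\<close>

definition push :: "nat \<Rightarrow> bool \<Rightarrow> instr list" where
  "push i b = [Move_Left i, Put i b]"

definition pop :: "nat \<Rightarrow> instr list" where
  "pop i = [Del i]"

text \<open>\<open>Branch i {} d\<close> is an unconditional jump, as no top lies in the empty set.
  Distances count from the branch itself: \<open>length c + 2\<close> leads past the body and its
  closing jump, and in a loop \<open>- length c - 1\<close> leads back to the test.\<close>

definition if_top :: "nat \<Rightarrow> bool set \<Rightarrow> instr list \<Rightarrow> instr list \<Rightarrow> instr list" where
  "if_top i A c d =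
     Branch i A (int (length c) + 2) # c @ Branch i {} (int (length d) + 1) # d"

definition while_top :: "nat \<Rightarrow> bool set \<Rightarrow> instr list \<Rightarrow> instr list" where
  "while_top i A c =
     Branch i A (int (length c) + 2) # c @ [Branch i {} (- int (length c) - 1)]"

lemma runs_push:
  assumes "i < num_stacks"
  shows "runs (push i b) s 2 (s(i := b # s i))"
proof (rule runsI)
  fix pre post ts
  assume ts: "holds_stacks ts s"
  let ?code = "pre @ push i b @ post"
  define ts1 where "ts1 = map (\<lambda>j. act (action (Move_Left i) j (head_symbol (ts ! j))) (ts ! j)) [0..<num_stacks]"
  define ts2 where "ts2 = map (\<lambda>j. act (action (Put i b) j (head_symbol (ts1 ! j))) (ts1 ! j)) [0..<num_stacks]"
  have "tm_step (machine ?code) (length pre, ts) = (Suc (length pre), ts1)"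
    using ts by (subst tm_step_machine) (auto simp: holds_stacks_def push_def nth_append ts1_def)
  moreover have "tm_step (machine ?code) (Suc (length pre), ts1) = (Suc (Suc (length pre)), ts2)"
    by (subst tm_step_machine) (auto simp: push_def nth_append ts1_def ts2_def)
  ultimately have "(tm_step (machine ?code) ^^ 2) (length pre, ts) =
      (length pre + length (push i b), ts2)"
    by (simp add: numeral_2_eq_2 push_def)
  moreover have "holds_stacks ts2 (s(i := b # s i))"
    unfolding holds_stacks_def
  proof (intro conjI allI impI)
    fix j :: nat assume j: "j < num_stacks"
    then obtain p where p: "ts ! j = word_tape p (s j)"
      using ts by (auto simp: holds_stacks_def)
    show "\<exists>p. ts2 ! j = word_tape p ((s(i := b # s i)) j)"
      using j p act_push[of b p "s j"] by (cases "j = i") (auto simp: ts2_def ts1_def)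
  qed (simp add: ts2_def)
  ultimately show "\<exists>t'\<le>2. \<exists>ts'. holds_stacks ts' (s(i := b # s i)) \<and>
      (tm_step (machine ?code) ^^ t') (length pre, ts) = (length pre + length (push i b), ts')"
    by blast
qed auto

lemma runs_pop:
  assumes "i < num_stacks" "s i = b # w"
  shows "runs (pop i) s 1 (s(i := w))"
proof (rule runsI)
  fix pre post ts
  assume ts: "holds_stacks ts s"
  let ?code = "pre @ pop i @ post"
  define ts1 where "ts1 = map (\<lambda>j. act (action (Del i) j (head_symbol (ts ! j))) (ts ! j)) [0..<num_stacks]"
  have "tm_step (machine ?code) (length pre, ts) = (Suc (length pre), ts1)"
    using ts by (subst tm_step_machine) (auto simp: holds_stacks_def pop_def nth_append ts1_def)
  then have "(tm_step (machine ?code) ^^ 1) (length pre, ts) =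
      (length pre + length (pop i), ts1)"
    by (simp add: pop_def)
  moreover have "holds_stacks ts1 (s(i := w))"
    unfolding holds_stacks_def
  proof (intro conjI allI impI)
    fix j :: nat assume j: "j < num_stacks"
    then obtain p where p: "ts ! j = word_tape p (s j)"
      using ts by (auto simp: holds_stacks_def)
    show "\<exists>p. ts1 ! j = word_tape p ((s(i := w)) j)"
      using j p act_pop[of p b w] assms by (cases "j = i") (auto simp: ts1_def)
  qed (simp add: ts1_def)
  ultimately show "\<exists>t'\<le>1. \<exists>ts'. holds_stacks ts' (s(i := w)) \<and>
      (tm_step (machine ?code) ^^ t') (length pre, ts) = (length pre + length (pop i), ts')"
    by blast
qed (use assms in auto)

lemma tm_step_Branch:
  assumes "q < length code" "code ! q = Branch i A d" "holds_stacks ts s" "i < num_stacks"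
    "0 \<le> int q + d" "int q + d \<le> int (length code)"
  shows "(tm_step (machine code) ^^ 1) (q, ts) =
    (if top_in (s i) A then q + 1 else nat (int q + d), ts)"
proof -
  obtain p where "ts ! i = word_tape p (s i)" and len: "length ts = num_stacks"
    using assms(3,4) by (auto simp: holds_stacks_def)
  then have top: "map head_symbol ts ! i \<in> bit_symbol ` A \<longleftrightarrow> top_in (s i) A"
    using assms(4) head_symbol_top_in by simp
  have "map (\<lambda>j. act (action (code ! q) j (head_symbol (ts ! j))) (ts ! j)) [0..<num_stacks] = ts"
    using len by (auto simp: assms(2) intro!: nth_equalityI)
  then have "tm_step (machine code) (q, ts) =
      (min (length code) (nat (int q + (if top_in (s i) A then 1 else d))), ts)"
    using tm_step_machine[OF assms(1) len] by (simp only: assms(2) jump.simps top)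
  also have "min (length code) (nat (int q + (if top_in (s i) A then 1 else d))) =
      (if top_in (s i) A then q + 1 else nat (int q + d))"
    using assms(1,5,6) by auto
  finally show ?thesis
    by simp
qed

lemma runs_if_True:
  assumes "i < num_stacks" "top_in (s i) A" and c: "runs c s t s'"
  shows "runs (if_top i A c d) s (t + 2) s'"
proof (rule runsI)
  show "length (s' j) \<le> length (s j) + (t + 2)" for j
    using runs_length[OF c, of j] by simp
  fix pre post ts
  assume ts: "holds_stacks ts s"
  let ?code = "pre @ if_top i A c d @ post" and ?q = "length pre"
  let ?step = "tm_step (machine ?code)"
  have 1: "(?step ^^ 1) (?q, ts) = (?q + 1, ts)"
    using ts assms
    by (subst tm_step_Branch[of _ _ i A "int (length c) + 2"])
       (auto simp: if_top_def nth_append)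
  from runs_stepsE[OF c ts, of ?code "pre @ [Branch i A (int (length c) + 2)]"
      "Branch i {} (int (length d) + 1) # d @ post" "?q + 1"]
  obtain u ts' where u: "u \<le> t" "holds_stacks ts' s'"
    "(?step ^^ u) (?q + 1, ts) = (?q + 1 + length c, ts')"
    by (auto simp: if_top_def)
  have 2: "(?step ^^ 1) (?q + 1 + length c, ts') = (?q + length (if_top i A c d), ts')"
    using u(2) assms
    by (subst tm_step_Branch[of _ _ i "{}" "int (length d) + 1"])
       (auto simp: if_top_def nth_append top_in_def nat_add_distrib nat_int_add)
  show "\<exists>t'\<le>t + 2. \<exists>ts'. holds_stacks ts' s' \<and>
      (?step ^^ t') (?q, ts) = (?q + length (if_top i A c d), ts')"
    using funpow_trans[OF 1 funpow_trans[OF u(3) 2]] u(1,2)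
    by (intro exI[of _ "1 + (u + 1)"]) auto
qed

lemma runs_if_False:
  assumes "i < num_stacks" "\<not> top_in (s i) A" and d: "runs d s t s'"
  shows "runs (if_top i A c d) s (t + 1) s'"
proof (rule runsI)
  show "length (s' j) \<le> length (s j) + (t + 1)" for j
    using runs_length[OF d, of j] by simp
  fix pre post ts
  assume ts: "holds_stacks ts s"
  let ?code = "pre @ if_top i A c d @ post" and ?q = "length pre"
  let ?step = "tm_step (machine ?code)"
  have 1: "(?step ^^ 1) (?q, ts) = (?q + length c + 2, ts)"
    using ts assms
    by (subst tm_step_Branch[of _ _ i A "int (length c) + 2"])
       (auto simp: if_top_def nth_append)
  from runs_stepsE[OF d ts, of ?code
      "pre @ Branch i A (int (length c) + 2) # c @ [Branch i {} (int (length d) + 1)]"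
      post "?q + length c + 2"]
  obtain u ts' where u: "u \<le> t" "holds_stacks ts' s'"
    "(?step ^^ u) (?q + length c + 2, ts) = (?q + length (if_top i A c d), ts')"
    by (auto simp: if_top_def add_ac)
  show "\<exists>t'\<le>t + 1. \<exists>ts'. holds_stacks ts' s' \<and>
      (?step ^^ t') (?q, ts) = (?q + length (if_top i A c d), ts')"
    using funpow_trans[OF 1 u(3)] u(1,2)
    by (intro exI[of _ "1 + u"]) auto
qed

lemma runs_while_False:
  assumes "i < num_stacks" "\<not> top_in (s i) A"
  shows "runs (while_top i A c) s 1 s"
proof (rule runsI)
  fix pre post ts
  assume ts: "holds_stacks ts s"
  let ?code = "pre @ while_top i A c @ post" and ?q = "length pre"
  have "(tm_step (machine ?code) ^^ 1) (?q, ts) = (?q + length (while_top i A c), ts)"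
    using ts assms
    by (subst tm_step_Branch[of _ _ i A "int (length c) + 2"])
       (auto simp: while_top_def nth_append)
  then show "\<exists>t'\<le>1. \<exists>ts'. holds_stacks ts' s \<and>
      (tm_step (machine ?code) ^^ t') (?q, ts) = (?q + length (while_top i A c), ts')"
    using ts by blast
qed auto

text \<open>One unfolding of the loop, with two steps for the test and the jump back. Loops are
  verified by induction on the data they consume, with this as the induction step.\<close>

lemma runs_while_True:
  assumes "i < num_stacks" "top_in (s i) A" and c: "runs c s t s'" and w: "runs (while_top i A c) s' t' s''"
  shows "runs (while_top i A c) s (t + t' + 2) s''"
proof (rule runsI)
  show "length (s'' j) \<le> length (s j) + (t + t' + 2)" for j
    using runs_length[OF c, of j] runs_length[OF w, of j] by simp
  fix pre post ts
  assume ts: "holds_stacks ts s"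
  let ?code = "pre @ while_top i A c @ post" and ?q = "length pre"
  let ?step = "tm_step (machine ?code)"
  have 1: "(?step ^^ 1) (?q, ts) = (?q + 1, ts)"
    using ts assms
    by (subst tm_step_Branch[of _ _ i A "int (length c) + 2"])
       (auto simp: while_top_def nth_append)
  from runs_stepsE[OF c ts, of ?code "pre @ [Branch i A (int (length c) + 2)]"
      "Branch i {} (- int (length c) - 1) # post" "?q + 1"]
  obtain u ts' where u: "u \<le> t" "holds_stacks ts' s'"
    "(?step ^^ u) (?q + 1, ts) = (?q + 1 + length c, ts')"
    by (auto simp: while_top_def)
  have 2: "(?step ^^ 1) (?q + 1 + length c, ts') = (?q, ts')"
    using u(2) assms
    by (subst tm_step_Branch[of _ _ i "{}" "- int (length c) - 1"])
       (auto simp: while_top_def nth_append top_in_def)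
  from runs_stepsE[OF w u(2), of ?code pre post ?q]
  obtain u' ts'' where u': "u' \<le> t'" "holds_stacks ts'' s''"
    "(?step ^^ u') (?q, ts') = (?q + length (while_top i A c), ts'')" by auto
  show "\<exists>v\<le>t + t' + 2. \<exists>ts'. holds_stacks ts' s'' \<and>
      (?step ^^ v) (?q, ts) = (?q + length (while_top i A c), ts')"
    using funpow_trans[OF 1 funpow_trans[OF u(3) funpow_trans[OF 2 u'(3)]]] u(1) u'(1,2)
    by (intro exI[of _ "1 + (u + (1 + u'))"]) auto
qed

text \<open>With no code around it, the end of the program is the halting state.\<close>

lemma runs_computes:
  assumes "runs c ((\<lambda>_. [])(0 := w)) t s"
  shows "tm_computes_within (machine c) w (s 0) t"
proof -
  have init: "tm_init (machine c) w = (0, word_tape 0 w # replicate (num_stacks - 1) (word_tape 0 []))"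
    by (simp add: tm_init_def machine_def)
  have "holds_stacks (word_tape 0 w # replicate (num_stacks - 1) (word_tape 0 [])) ((\<lambda>_. [])(0 := w))"
    by (auto simp: holds_stacks_def nth_Cons' num_stacks_def)
  from runs_stepsE[OF assms this, of c "[]" "[]" 0] obtain t' ts' where
    *: "t' \<le> t" "holds_stacks ts' s" "(tm_step (machine c) ^^ t') (tm_init (machine c) w) = (length c, ts')"
    by (auto simp: init)
  from *(2) obtain p where "ts' ! 0 = word_tape p (s 0)" "length ts' = num_stacks"
    unfolding holds_stacks_def by (metis num_stacks_def zero_less_numeral)
  then have "ts' = word_tape p (s 0) # tl ts'"
    by (cases ts') (auto simp: num_stacks_def)
  moreover have "states (machine c) = length c"
    by (simp add: machine_def)
  ultimately show ?thesis
    using * unfolding tm_computes_within_def by metis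
qed

text \<open>Serves symbolic execution: the rules for the parts determine \<open>s'\<close> and
  \<open>t\<close>, and then only an equation of stacks and an inequality of times remain.\<close>

lemma runs_cong: "runs c s t s' \<Longrightarrow> s' = s'' \<Longrightarrow> t \<le> t' \<Longrightarrow> runs c s t' s''"
  using runs_mono by blast

definition emit :: "nat \<Rightarrow> bool list \<Rightarrow> instr list" where
  "emit i bs = concat (map (push i) bs)"

lemma runs_emit:
  assumes "i < num_stacks"
  shows "runs (emit i bs) s (2 * length bs) (s(i := rev bs @ s i))"
proof (induction bs arbitrary: s)
  case Nil
  then show ?case using runs_Nil by (simp add: emit_def)
next
  case (Cons b bs)
  have "runs (push i b @ emit i bs) s (2 + 2 * length bs)
      ((s(i := b # s i))(i := rev bs @ (s(i := b # s i)) i))"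
    by (rule runs_append[OF runs_push[OF assms] Cons.IH])
  then have "runs (emit i (b # bs)) s (2 + 2 * length bs)
      ((s(i := b # s i))(i := rev bs @ (s(i := b # s i)) i))"
    by (simp only: emit_def list.map concat.simps)
  then show ?case by (rule runs_cong) auto
qed

text \<open>The states \<open>S k\<close> are indexed by the number of iterations that are still to come.\<close>

lemma runs_unary_loop:
  assumes i: "i < num_stacks" and r: "\<not> top_in r {True}"
    and S: "\<And>k. k \<le> n \<Longrightarrow> S k i = replicate k True @ r"
    and c: "\<And>k. k < n \<Longrightarrow> runs c ((S (Suc k))(i := replicate k True @ r)) t (S k)"
  shows "runs (while_top i {True} (pop i @ c)) (S n) (n * (t + 3) + 1) (S 0)"
  using S c
proof (induction n)
  case 0
  then show ?case using runs_while_False[OF i, of "S 0" "{True}"] r by simp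
next
  case (Suc n)
  have "runs (pop i) (S (Suc n)) 1 ((S (Suc n))(i := replicate n True @ r))"
    using runs_pop[OF i, of "S (Suc n)" True] Suc.prems(1)[of "Suc n"] by simp
  from runs_append[OF this Suc.prems(2)[of n]]
  have "runs (pop i @ c) (S (Suc n)) (1 + t) (S n)" by simp
  moreover have "runs (while_top i {True} (pop i @ c)) (S n) (n * (t + 3) + 1) (S 0)"
    using Suc.prems by (intro Suc.IH) auto
  ultimately have "runs (while_top i {True} (pop i @ c)) (S (Suc n))
      ((1 + t) + (n * (t + 3) + 1) + 2) (S 0)"
    using Suc.prems(1)[of "Suc n"] by (intro runs_while_True[OF i]) auto
  then show ?case by (rule runs_mono) (simp add: algebra_simps)
qed

section \<open>Moving and copying data between stacks\<close>

definition move_bit :: "nat \<Rightarrow> nat \<Rightarrow> instr list" where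
  "move_bit i j = if_top i {True} (pop i @ push j True) (pop i @ push j False)"

lemma runs_move_bit:
  assumes "i < num_stacks" "j < num_stacks" "i \<noteq> j" "s i = b # w"
  shows "runs (move_bit i j) s 5 (s(i := w, j := b # s j))"
proof -
  have *: "runs (pop i @ push j b) s 3 (s(i := w, j := b # s j))" for b
    using runs_append[OF runs_pop[OF assms(1), of s, OF assms(4)] runs_push[OF assms(2), of b]]
      assms(3) by (auto simp: numeral_eq_Suc)
  show ?thesis
  proof (cases b)
    case True
    then show ?thesis
      using runs_if_True[OF assms(1) _ *[of True]] assms(4) by (simp add: move_bit_def)
  next
    case False
    then have "runs (move_bit i j) s (3 + 1) (s(i := w, j := False # s j))"
      unfolding move_bit_def using assms(4) by (intro runs_if_False[OF assms(1) _ *]) auto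
    with False show ?thesis by (auto intro: runs_mono)
  qed
qed

definition pour :: "nat \<Rightarrow> nat \<Rightarrow> instr list" where
  "pour i j = while_top i UNIV (move_bit i j)"

lemma runs_pour:
  assumes "i < num_stacks" "j < num_stacks" "i \<noteq> j"
  shows "runs (pour i j) s (7 * length (s i) + 1) (s(i := [], j := rev (s i) @ s j))"
proof (induction "s i" arbitrary: s)
  case Nil
  then have "s(i := [], j := rev (s i) @ s j) = s"
    using assms by (auto simp: fun_eq_iff)
  with Nil show ?case
    using runs_while_False[OF assms(1), of s UNIV]
    by (metis pour_def add_0 list.size(3) mult_0_right top_in_simps(1))
next
  case (Cons b w)
  let ?s = "s(i := w, j := b # s j)"
  have "runs (while_top i UNIV (move_bit i j)) s (5 + (7 * length (?s i) + 1) + 2)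
      (?s(i := [], j := rev (?s i) @ ?s j))"
  proof (rule runs_while_True[OF assms(1)])
    show "top_in (s i) UNIV" by (simp flip: Cons.hyps(2))
    show "runs (move_bit i j) s 5 ?s"
      by (rule runs_move_bit[of i j s, OF assms Cons.hyps(2)[symmetric]])
    show "runs (while_top i UNIV (move_bit i j)) ?s (7 * length (?s i) + 1)
        (?s(i := [], j := rev (?s i) @ ?s j))"
      using Cons.hyps(1)[of ?s] assms(3) by (simp add: pour_def)
  qed
  then show ?case
    unfolding pour_def
    by (rule runs_cong) (use assms(3) in \<open>auto simp: fun_eq_iff simp flip: Cons.hyps(2)\<close>)
qed

text \<open>\<open>enc_nat\<close> writes \<open>True\<close> before each digit and ends with
  \<open>False\<close>. Moving two bits per round keeps the test on these markers, so a digit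
  \<open>False\<close> cannot end the loop.\<close>

definition copy_nat :: "nat \<Rightarrow> nat \<Rightarrow> instr list" where
  "copy_nat i j = while_top i {True} (move_bit i j @ move_bit i j) @ move_bit i j"

lemma runs_copy_nat:
  assumes "i < num_stacks" "j < num_stacks" "i \<noteq> j" "s i = enc_nat m @ w"
  shows "runs (copy_nat i j) s (6 * length (enc_nat m)) (s(i := w, j := rev (enc_nat m) @ s j))"
proof -
  define pairs :: "bool list \<Rightarrow> bool list" where "pairs bs = concat (map (\<lambda>b. [True, b]) bs)" for bs
  have loop: "runs (while_top i {True} (move_bit i j @ move_bit i j)) s (6 * length (pairs bs) + 1)
      (s(i := False # w, j := rev (pairs bs) @ s j))"
    if "s i = pairs bs @ False # w" for bs s
    using that
  proof (induction bs arbitrary: s)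
    case Nil
    then have s: "s i = False # w" by (simp add: pairs_def)
    then have "runs (while_top i {True} (move_bit i j @ move_bit i j)) s 1 s"
      by (intro runs_while_False[OF assms(1)]) simp
    then show ?case
      by (rule runs_cong) (use s in \<open>auto simp: pairs_def\<close>)
  next
    case (Cons b bs)
    have s: "s i = True # b # pairs bs @ False # w" using Cons.prems by (simp add: pairs_def)
    let ?s1 = "s(i := b # pairs bs @ False # w, j := True # s j)"
    let ?s2 = "?s1(i := pairs bs @ False # w, j := b # ?s1 j)"
    let ?s3 = "?s2(i := False # w, j := rev (pairs bs) @ ?s2 j)"
    have 2: "runs (move_bit i j @ move_bit i j) s (5 + 5) ?s2"
      using s assms by (intro runs_append[where s' = ?s1] runs_move_bit) auto
    have 3: "runs (while_top i {True} (move_bit i j @ move_bit i j)) ?s2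
        (6 * length (pairs bs) + 1) ?s3"
      using assms(3) by (intro Cons.IH) auto
    have "top_in (s i) {True}" by (simp add: s)
    from runs_while_True[OF assms(1) this 2 3] show ?case
      by (rule runs_cong) (use assms(3) in \<open>auto simp: pairs_def fun_eq_iff\<close>)
  qed
  let ?p = "pairs (nat_bits m)"
  have enc: "enc_nat m = ?p @ [False]"
    by (simp add: enc_nat_def enc_list_def pairs_def)
  have "runs (while_top i {True} (move_bit i j @ move_bit i j)) s (6 * length ?p + 1)
      (s(i := False # w, j := rev ?p @ s j))" (is "runs _ _ _ ?s")
    using assms(4) by (intro loop) (simp add: enc)
  moreover have "runs (move_bit i j) ?s 5 (?s(i := w, j := False # ?s j))"
    using assms by (intro runs_move_bit) auto
  ultimately have "runs (copy_nat i j) s (6 * length ?p + 1 + 5) (?s(i := w, j := False # ?s j))"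
    unfolding copy_nat_def by (rule runs_append)
  then show ?thesis
    by (rule runs_cong) (use assms(3) in \<open>auto simp: enc fun_eq_iff\<close>)
qed

definition copy_rat :: "nat \<Rightarrow> nat \<Rightarrow> instr list" where
  "copy_rat i j = move_bit i j @ copy_nat i j @ move_bit i j @ copy_nat i j"

text \<open>The stacks are: the input (finally the output), the part of the output before the last form
  and the last form (both upside down), the number of the current variable in unary, an auxiliary
  stack that is empty between uses, and the number of variables that have been boxed.\<close>

definition stacks ::
  "bool list \<Rightarrow> bool list \<Rightarrow> bool list \<Rightarrow> bool list \<Rightarrow> bool list \<Rightarrow> bool list \<Rightarrow> nat \<Rightarrow> bool list" where
  "stacks a b c d e f = (\<lambda>_. [])(0 := a, 1 := b, 2 := c, 3 := d, 4 := e, 5 := f)"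

lemma stacks_apply [simp]:
  "stacks a b c d e f 0 = a" "stacks a b c d e f (Suc 0) = b" "stacks a b c d e f 2 = c"
  "stacks a b c d e f 3 = d" "stacks a b c d e f 4 = e" "stacks a b c d e f 5 = f"
  by (auto simp: stacks_def)

lemma stacks_update [simp]:
  "(stacks a b c d e f)(0 := x) = stacks x b c d e f"
  "(stacks a b c d e f)(Suc 0 := x) = stacks a x c d e f"
  "(stacks a b c d e f)(2 := x) = stacks a b x d e f"
  "(stacks a b c d e f)(3 := x) = stacks a b c x e f"
  "(stacks a b c d e f)(4 := x) = stacks a b c d x f"
  "(stacks a b c d e f)(5 := x) = stacks a b c d e x"
  by (auto simp: stacks_def fun_eq_iff)

lemma less_num_stacks [simp]:
  "0 < num_stacks" "Suc 0 < num_stacks" "2 < num_stacks" "3 < num_stacks" "4 < num_stacks"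
  "5 < num_stacks"
  by (auto simp: num_stacks_def)

lemma runs_emit_stacks:
  "runs (emit 0 bs) (stacks a b c d e f) (2 * length bs) (stacks (rev bs @ a) b c d e f)"
  "runs (emit 1 bs) (stacks a b c d e f) (2 * length bs) (stacks a (rev bs @ b) c d e f)"
  "runs (emit 2 bs) (stacks a b c d e f) (2 * length bs) (stacks a b (rev bs @ c) d e f)"
  "runs (emit 3 bs) (stacks a b c d e f) (2 * length bs) (stacks a b c (rev bs @ d) e f)"
  "runs (emit 4 bs) (stacks a b c d e f) (2 * length bs) (stacks a b c d (rev bs @ e) f)"
  "runs (emit 5 bs) (stacks a b c d e f) (2 * length bs) (stacks a b c d e (rev bs @ f))"
  using runs_emit[of _ bs "stacks a b c d e f"] by (metis less_num_stacks One_nat_def stacks_apply stacks_update)+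

lemma runs_pop_input: "runs (pop 0) (stacks (x # a) b c d e f) 1 (stacks a b c d e f)"
  using runs_pop[of 0 "stacks (x # a) b c d e f"] by simp

lemma runs_copy_rat:
  "runs (copy_rat 0 2) (stacks (enc_rat q @ a) b c d e f) (6 * length (enc_rat q))
     (stacks a b (rev (enc_rat q) @ c) d e f)"
proof -
  obtain u v where q: "quotient_of q = (u, v)" by force
  have bit: "runs (move_bit 0 2) (stacks (x # a) b c d e f) 5 (stacks a b (x # c) d e f)" for x a c
    using runs_move_bit[of 0 2 "stacks (x # a) b c d e f"] by simp
  have nat: "runs (copy_nat 0 2) (stacks (enc_nat m @ a) b c d e f) (6 * length (enc_nat m))
      (stacks a b (rev (enc_nat m) @ c) d e f)" for m a c
    using runs_copy_nat[of 0 2 "stacks (enc_nat m @ a) b c d e f"] by simp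
  show ?thesis
    unfolding copy_rat_def enc_rat_def q prod.case enc_int_def append_Cons append_assoc
    by (rule runs_cong, (rule runs_append bit nat)+) auto
qed

text \<open>Reading the counter on stack 3 destroys it, so it is saved on stack 4 and restored. Each
  unit yields two bits; the last two bits add one and terminate the unary index
  \<open>2 * j + 1\<close>.\<close>

definition emit_index :: "nat \<Rightarrow> instr list" where
  "emit_index i = while_top 3 {True} (pop 3 @ emit 4 [True] @ emit i [True, True]) @
     while_top 4 {True} (pop 4 @ emit 3 [True]) @ emit i [True, False]"

lemma replicate_Suc_diff: "k < n \<Longrightarrow> replicate (n - k) x = x # replicate (n - Suc k) x"
  by (metis Suc_diff_Suc replicate_Suc)

lemma replicate_double_Suc_diff:
  "k < n \<Longrightarrow> replicate (2 * (n - k)) x = x # x # replicate (2 * (n - Suc k)) x"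
  by (simp add: Suc_diff_Suc [symmetric])

lemma rev_enc_unary: "rev (enc_unary n) = False # replicate n True"
  by (simp add: enc_unary_def)

lemma runs_restore:
  "runs (while_top 4 {True} (pop 4 @ emit 3 [True]))
     (stacks a b c [] (replicate j True) f) (5 * j + 1) (stacks a b c (replicate j True) [] f)"
proof -
  let ?S = "\<lambda>k. stacks a b c (replicate (j - k) True) (replicate k True) f"
  have "runs (while_top 4 {True} (pop 4 @ emit 3 [True])) (?S j) (j * (2 + 3) + 1) (?S 0)"
  proof (rule runs_unary_loop[where r = "[]"])
    fix k assume "k < j"
    then show "runs (emit 3 [True]) ((?S (Suc k))(4 := replicate k True @ [])) 2 (?S k)"
      using runs_emit_stacks(4)[of "[True]" a b c "replicate (j - Suc k) True" "replicate k True" f]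
      by (simp add: replicate_Suc_diff)
  qed simp_all
  then show ?thesis by (simp add: mult.commute)
qed

lemma runs_emit_index:
  "runs (emit_index 1) (stacks a b c (replicate j True) [] f) (14 * j + 6)
     (stacks a (rev (enc_unary (2 * j + 1)) @ b) c (replicate j True) [] f)"
  "runs (emit_index 2) (stacks a b c (replicate j True) [] f) (14 * j + 6)
     (stacks a b (rev (enc_unary (2 * j + 1)) @ c) (replicate j True) [] f)"
proof -
  let ?S = "\<lambda>k. stacks a (replicate (2 * (j - k)) True @ b) c (replicate k True) (replicate (j - k) True) f"
  let ?c = "emit 4 [True] @ emit 1 [True, True]"
  have "runs (while_top 3 {True} (pop 3 @ ?c)) (?S j) (j * (6 + 3) + 1) (?S 0)"
  proof (rule runs_unary_loop[where r = "[]"])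
    fix k assume k: "k < j"
    show "runs ?c ((?S (Suc k))(3 := replicate k True @ [])) 6 (?S k)"
      unfolding stacks_update
      by (rule runs_cong, (rule runs_append runs_emit_stacks)+)
         (simp_all add: replicate_Suc_diff[OF k] replicate_double_Suc_diff[OF k])
  qed simp_all
  then have loop: "runs (while_top 3 {True} (pop 3 @ ?c)) (stacks a b c (replicate j True) [] f) (9 * j + 1)
      (stacks a (replicate (2 * j) True @ b) c [] (replicate j True) f)"
    by (simp add: mult.commute)
  show "runs (emit_index 1) (stacks a b c (replicate j True) [] f) (14 * j + 6)
      (stacks a (rev (enc_unary (2 * j + 1)) @ b) c (replicate j True) [] f)"
    unfolding emit_index_def
    by (rule runs_cong, (rule runs_append loop runs_restore runs_emit_stacks)+)
       (simp_all add: rev_enc_unary)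
next
  let ?S = "\<lambda>k. stacks a b (replicate (2 * (j - k)) True @ c) (replicate k True) (replicate (j - k) True) f"
  let ?c = "emit 4 [True] @ emit 2 [True, True]"
  have "runs (while_top 3 {True} (pop 3 @ ?c)) (?S j) (j * (6 + 3) + 1) (?S 0)"
  proof (rule runs_unary_loop[where r = "[]"])
    fix k assume k: "k < j"
    show "runs ?c ((?S (Suc k))(3 := replicate k True @ [])) 6 (?S k)"
      unfolding stacks_update
      by (rule runs_cong, (rule runs_append runs_emit_stacks)+)
         (simp_all add: replicate_Suc_diff[OF k] replicate_double_Suc_diff[OF k])
  qed simp_all
  then have loop: "runs (while_top 3 {True} (pop 3 @ ?c)) (stacks a b c (replicate j True) [] f) (9 * j + 1)
      (stacks a b (replicate (2 * j) True @ c) [] (replicate j True) f)"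
    by (simp add: mult.commute)
  show "runs (emit_index 2) (stacks a b c (replicate j True) [] f) (14 * j + 6)
      (stacks a b (rev (enc_unary (2 * j + 1)) @ c) (replicate j True) [] f)"
    unfolding emit_index_def
    by (rule runs_cong, (rule runs_append loop runs_restore runs_emit_stacks)+)
       (simp_all add: rev_enc_unary)
qed

section \<open>The quadratic forms\<close>

text \<open>Variable \<open>0\<close> is the homogenizing variable \<open>t\<close>. The quantity with number \<open>j\<close> is variable
  \<open>2 * j + 1\<close>, and \<open>2 * j + 2\<close> is its slack variable. The quantities below \<open>n\<close> are the
  variables of the quartic; those from \<open>n\<close> on are the partial products of its terms, one term
  after the other, starting with the empty product.\<close>

definition start_form :: "nat \<Rightarrow> terms" where
  "start_form j = [([0, 2 * j + 1], 1), ([0, 0], - 1)]"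

text \<open>Variable \<open>2 * j + 3\<close> is quantity \<open>j + 1\<close>, so a zero of the
  form says that t times this quantity is quantity \<open>j\<close> times quantity
  \<open>v\<close>.\<close>

definition step_form :: "nat \<Rightarrow> nat \<Rightarrow> terms" where
  "step_form j v = [([2 * j + 1, 2 * v + 1], - 1), ([0, 2 * j + 3], 1)]"

definition box_form :: "nat \<Rightarrow> terms" where
  "box_form j = [([2 * j + 1, 2 * j + 1], 1), ([2 * j + 2, 2 * j + 2], 1), ([0, 0], - 1)]"

fun chain_forms :: "nat \<Rightarrow> nat list \<Rightarrow> terms list" where
  "chain_forms j [] = []"
| "chain_forms j (v # vs) = step_form j v # chain_forms (Suc j) vs"

fun product_forms :: "nat \<Rightarrow> terms \<Rightarrow> terms list" where
  "product_forms j [] = []"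
| "product_forms j ((vs, c) # ts) =
     start_form j # chain_forms j vs @ product_forms (Suc (j + length vs)) ts"

text \<open>Quantity \<open>j\<close> is the empty product of the first term, so its full product is
  quantity \<open>j + length vs\<close>, and the next term starts right after it.\<close>

fun value_form :: "nat \<Rightarrow> terms \<Rightarrow> terms" where
  "value_form j [] = []"
| "value_form j ((vs, c) # ts) =
     ([0, 2 * (j + length vs) + 1], c) # value_form (Suc (j + length vs)) ts"

fun end_index :: "nat \<Rightarrow> terms \<Rightarrow> nat" where
  "end_index j [] = j"
| "end_index j ((vs, c) # ts) = end_index (Suc (j + length vs)) ts"

text \<open>The order suits the machine: the boxes are written while the counter runs down, and the
  value form, collected on a stack of its own, comes last.\<close>

definition reduced_forms :: "nat \<Rightarrow> terms \<Rightarrow> terms list" where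
  "reduced_forms n ts =
     product_forms n ts @ map box_form (rev [0..<end_index n ts]) @ [value_form n ts]"

lemma end_index_ge: "j \<le> end_index j ts"
  by (induction j ts rule: end_index.induct) auto

section \<open>Computing the forms\<close>

text \<open>The bit strings are the constant pieces of \<open>enc_terms (start_form j)\<close>, led
  by the marker of the enclosing list; only the index \<open>2 * j + 1\<close> depends on the
  counter.\<close>

definition emit_start :: "instr list" where
  "emit_start = emit 1 [True, True, True, False, True] @ emit_index 1 @
     emit 1 (False # enc_rat 1 @ [True, True, False, True, False, False] @ enc_rat (- 1) @ [False])"

text \<open>The index \<open>2 * v + 1\<close> arises by doubling the unary input and adding one
  bit. Incrementing the counter before the last index makes that index \<open>2 * j + 3\<close> and
  prepares the next factor.\<close>

definition emit_step :: "instr list" where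
  "emit_step = pop 0 @ emit 1 [True, True, True] @ emit_index 1 @ emit 1 [True] @
     while_top 0 {True} (pop 0 @ emit 1 [True, True]) @ pop 0 @
     emit 1 ([True, False, False] @ enc_rat (- 1) @ [True, True, False, True]) @
     emit 3 [True] @ emit_index 1 @ emit 1 (False # enc_rat 1 @ [False])"

text \<open>An additional \<open>True\<close> before \<open>emit_index\<close> turns
  \<open>2 * j + 1\<close> into the slack index \<open>2 * j + 2\<close>. Stack 5 counts the boxes,
  for the number of variables at the start of the output.\<close>

definition emit_box :: "instr list" where
  "emit_box = emit 5 [True] @ emit 1 [True, True, True] @ emit_index 1 @ emit 1 [True] @
     emit_index 1 @ emit 1 (False # enc_rat 1 @ [True, True, True]) @ emit_index 1 @
     emit 1 [True, True] @ emit_index 1 @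
     emit 1 (False # enc_rat 1 @ [True, True, False, True, False, False] @ enc_rat (- 1) @ [False])"

definition emit_term :: "instr list" where
  "emit_term = pop 0 @ emit_start @ while_top 0 {True} emit_step @ pop 0 @
     emit 2 [True, True, False, True] @ emit_index 2 @ emit 2 [False] @ copy_rat 0 2 @
     emit 3 [True]"

text \<open>As pushing builds a word from its end, the output is assembled backwards on the emptied
  input stack: value form, other forms, number of variables. The single \<open>True\<close> on stack
  2 is the list marker of the value form; the two \<open>False\<close> close its terms and the list
  of forms.\<close>

definition reduction_code :: "instr list" where
  "reduction_code =
     while_top 0 {True} (pop 0 @ emit 3 [True]) @ pop 0 @
     emit 2 [True] @ while_top 0 {True} emit_term @ pop 0 @
     while_top 3 {True} (pop 3 @ emit_box) @
     emit 2 [False, False] @ pour 2 0 @ pour 1 0 @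
     emit 0 [False, True] @ while_top 5 {True} (pop 5 @ emit 0 [True, True])"

section \<open>Results and running times of the parts of the program\<close>

lemma runs_increment:
  "runs (emit 3 [True]) (stacks a b c (replicate j True) e f) 2
     (stacks a b c (replicate (Suc j) True) e f)"
  using runs_emit_stacks(4)[of "[True]" a b c "replicate j True" e f] by simp

lemma length_enc_rat_1 [simp]: "length (enc_rat 1) = 8" "length (enc_rat (- 1)) = 8"
  by (simp_all add: enc_rat_def enc_int_def enc_nat_def enc_list_def nat_bits_pos nat_bits_0 rat_uminus_code)

lemma enc_terms_Nil: "enc_terms [] = [False]"
  by (simp add: enc_terms_def enc_list_def)

lemma enc_terms_Cons:
  "enc_terms ((vs, c) # ts) = True # enc_list enc_unary vs @ enc_rat c @ enc_terms ts"
  by (simp add: enc_terms_def enc_list_def)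

lemma enc_unary_0: "enc_unary 0 = [False]"
  by (simp add: enc_unary_def)

lemma enc_unary_Suc: "enc_unary (Suc n) = True # enc_unary n"
  by (simp add: enc_unary_def)

lemma enc_list_Nil: "enc_list e [] = [False]"
  by (simp add: enc_list_def)

lemma enc_list_Cons: "enc_list e (x # xs) = True # e x @ enc_list e xs"
  by (simp add: enc_list_def)

lemmas enc_simps = enc_terms_Nil enc_terms_Cons enc_list_Nil enc_list_Cons enc_unary_0

lemma runs_emit_start:
  "runs emit_start (stacks a b c (replicate j True) [] f) (14 * j + 70)
     (stacks a (rev (True # enc_terms (start_form j)) @ b) c (replicate j True) [] f)"
  unfolding emit_start_def
  by (rule runs_cong, (rule runs_append runs_emit_stacks runs_emit_index)+)
     (simp_all add: start_form_def enc_simps)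

lemma runs_emit_box:
  "runs emit_box (stacks a b c (replicate j True) [] f) (56 * j + 150)
     (stacks a (rev (True # enc_terms (box_form j)) @ b) c (replicate j True) [] (True # f))"
  unfolding emit_box_def
  by (rule runs_cong, (rule runs_append runs_emit_stacks runs_emit_index)+)
     (simp_all add: box_form_def enc_simps enc_unary_Suc)

lemma runs_copy_variable:
  "runs (while_top 0 {True} (pop 0 @ emit 1 [True, True])) (stacks (enc_unary v @ a) b c d e f)
     (7 * v + 1) (stacks (False # a) (replicate (2 * v) True @ b) c d e f)"
proof -
  let ?S = "\<lambda>k. stacks (replicate k True @ False # a) (replicate (2 * (v - k)) True @ b) c d e f"
  have "runs (while_top 0 {True} (pop 0 @ emit 1 [True, True])) (?S v) (v * (4 + 3) + 1) (?S 0)"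
  proof (rule runs_unary_loop[where r = "False # a"])
    fix k assume k: "k < v"
    show "runs (emit 1 [True, True]) ((?S (Suc k))(0 := replicate k True @ False # a)) 4 (?S k)"
      unfolding stacks_update
      by (rule runs_cong, rule runs_emit_stacks) (simp_all add: replicate_double_Suc_diff[OF k])
  qed simp_all
  then show ?thesis by (simp add: enc_unary_def mult.commute)
qed

lemma runs_emit_step:
  "runs emit_step (stacks (True # enc_unary v @ a) b c (replicate j True) [] f) (28 * j + 7 * v + 120)
     (stacks a (rev (True # enc_terms (step_form j v)) @ b) c (replicate (Suc j) True) [] f)"
proof -
  have *: "2 * j + 3 = Suc (Suc (Suc (2 * j)))" by simp
  show ?thesis
    unfolding emit_step_def
    by (rule runs_cong, (rule runs_append runs_pop_input runs_copy_variable runs_increment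
          runs_emit_stacks runs_emit_index)+)
       (simp_all add: step_form_def enc_simps rev_enc_unary *)
qed

text \<open>With \<open>m\<close> bounding the counter, each bit of input is charged
  \<open>28 * m + 200\<close> steps. Such charges add up along the input, so the enclosing loop
  needs no separate count of its rounds.\<close>

lemma runs_chain:
  assumes "j + length vs \<le> m"
  shows "runs (while_top 0 {True} emit_step)
      (stacks (enc_list enc_unary vs @ a) b c (replicate j True) [] f)
      ((28 * m + 200) * length (enc_list enc_unary vs))
      (stacks (False # a) (rev (concat (map (\<lambda>q. True # enc_terms q) (chain_forms j vs))) @ b) c
         (replicate (j + length vs) True) [] f)"
  using assms
proof (induction vs arbitrary: j b)
  case Nil
  show ?case
    by (rule runs_cong, rule runs_while_False) (auto simp: enc_simps)
next
  case (Cons v vs)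
  define D where "D = 28 * m + 200"
  define l where "l = length (enc_list enc_unary vs)"
  have IH: "runs (while_top 0 {True} emit_step)
      (stacks (enc_list enc_unary vs @ a) b c (replicate (Suc j) True) [] f) (D * l)
      (stacks (False # a) (rev (concat (map (\<lambda>q. True # enc_terms q) (chain_forms (Suc j) vs))) @ b) c
         (replicate (Suc j + length vs) True) [] f)" for b
    unfolding D_def l_def using Cons.prems by (intro Cons.IH) simp
  \<comment> \<open>A round consumes \<open>v + 2\<close> bits, a marker and
    \<open>enc_unary v\<close>; the final 2 pays for the branches of the loop.\<close>
  have "28 * j + 7 * v + 120 + D * l + 2 \<le> D * (v + 2 + l)"
  proof -
    have "7 * v \<le> D * v" "28 * j + 122 \<le> D * 2"
      using Cons.prems by (auto simp: D_def)
    then show ?thesis unfolding distrib_left by linarith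
  qed
  then show ?case
    unfolding enc_list_Cons append_Cons append_assoc D_def[symmetric]
    by (intro runs_cong[OF runs_while_True[OF _ _ runs_emit_step IH]])
       (auto simp: l_def enc_unary_def)
qed

text \<open>The subtracted 2 leaves room for the two branches of the loop over the terms.\<close>

lemma runs_emit_term:
  assumes "j + length vs \<le> m"
  shows "runs emit_term
      (stacks (True # enc_list enc_unary vs @ enc_rat q @ a) b c (replicate j True) [] f)
      ((28 * m + 200) * (length (enc_list enc_unary vs) + length (enc_rat q) + 1) - 2)
      (stacks a
         (rev (concat (map (\<lambda>q. True # enc_terms q) (start_form j # chain_forms j vs))) @ b)
         (rev (True # enc_list enc_unary [0, 2 * (j + length vs) + 1] @ enc_rat q) @ c)
         (replicate (Suc (j + length vs)) True) [] f)"
proof -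
  define D where "D = 28 * m + 200"
  define l r where "l = length (enc_list enc_unary vs)" and "r = length (enc_rat q)"
  have "6 * r \<le> D * r" "28 * j + 14 * length vs + 150 \<le> D"
    using assms by (auto simp: D_def)
  moreover have "D * (l + r + 1) = D * l + D * r + D"
    by (simp add: algebra_simps)
  ultimately have time: "28 * j + 14 * length vs + 100 + D * l + 6 * r \<le> D * (l + r + 1) - 2"
    by linarith
  show ?thesis
    unfolding emit_term_def D_def[symmetric] l_def[symmetric] r_def[symmetric]
    by (rule runs_cong, (rule runs_append runs_pop_input runs_emit_start
        runs_chain[OF assms, folded D_def] runs_increment runs_emit_stacks runs_emit_index runs_copy_rat)+)
       (simp add: enc_simps, rule order_trans[OF _ time], simp add: l_def r_def)
qed

text \<open>\<open>butlast\<close> appears because the bit closing the value form is written only at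
  the end of the program.\<close>

lemma runs_terms:
  assumes "end_index j ts \<le> m"
  shows "runs (while_top 0 {True} emit_term) (stacks (enc_terms ts @ a) b c (replicate j True) [] f)
      ((28 * m + 200) * length (enc_terms ts))
      (stacks (False # a)
         (rev (concat (map (\<lambda>q. True # enc_terms q) (product_forms j ts))) @ b)
         (rev (butlast (enc_terms (value_form j ts))) @ c)
         (replicate (end_index j ts) True) [] f)"
  using assms
proof (induction ts arbitrary: j b c)
  case Nil
  show ?case
    by (rule runs_cong, rule runs_while_False) (auto simp: enc_simps)
next
  case (Cons x ts)
  obtain vs q where x: "x = (vs, q)" by force
  define D where "D = 28 * m + 200"
  define j' where "j' = Suc (j + length vs)"
  have m: "end_index j' ts \<le> m" using Cons.prems by (simp add: x j'_def)
  then have le: "j + length vs \<le> m"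
    using end_index_ge[of j' ts] by (simp add: j'_def)
  note IH = Cons.IH[OF m, folded D_def]
  note T = runs_emit_term[OF le, of q, folded D_def j'_def]
  have ne: "enc_terms us \<noteq> []" for us
    by (cases us) (auto simp: enc_terms_def enc_list_def)
  have "D > 2" by (simp add: D_def)
  then have "D * (length (enc_list enc_unary vs) + length (enc_rat q) + 1) - 2 +
      D * length (enc_terms ts) + 2 \<le> D * length (enc_terms (x # ts))"
    by (simp add: x enc_simps algebra_simps)
  then show ?case
    unfolding x enc_terms_Cons append_Cons append_assoc D_def[symmetric]
    by (intro runs_cong[OF runs_while_True[OF _ _ T IH]])
       (auto simp: x enc_simps j'_def butlast_append ne)
qed

text \<open>Every term and every occurrence of a variable takes at least one bit of the encoding.
  Hence the counter stays linear in the input size.\<close>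

lemma end_index_le: "end_index j ts \<le> j + length (enc_terms ts)"
proof -
  have "length vs \<le> length (enc_list enc_unary vs)" for vs
    by (induction vs) (auto simp: enc_simps)
  then show ?thesis
    by (induction j ts rule: end_index.induct) (fastforce simp: enc_simps intro: order_trans)+
qed

lemma runs_boxes:
  "runs (while_top 3 {True} (pop 3 @ emit_box)) (stacks a b c (replicate m True) [] [])
     (m * (56 * m + 153) + 1)
     (stacks a (rev (concat (map (\<lambda>q. True # enc_terms q) (map box_form (rev [0..<m])))) @ b) c
        [] [] (replicate m True))"
proof -
  let ?S = "\<lambda>k. stacks a (rev (concat (map (\<lambda>q. True # enc_terms q) (map box_form (rev [k..<m])))) @ b)
     c (replicate k True) [] (replicate (m - k) True)"
  have "runs (while_top 3 {True} (pop 3 @ emit_box)) (?S m) (m * (56 * m + 150 + 3) + 1) (?S 0)"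
  proof (rule runs_unary_loop[where r = "[]"])
    fix k assume k: "k < m"
    then show "runs emit_box ((?S (Suc k))(3 := replicate k True @ [])) (56 * m + 150) (?S k)"
      unfolding stacks_update append_Nil2
      by - (rule runs_cong, rule runs_emit_box,
         simp_all add: replicate_Suc_diff upt_conv_Cons)
  qed simp_all
  then show ?thesis by (simp add: add.commute)
qed

lemma runs_read_number:
  "runs (while_top 0 {True} (pop 0 @ emit 3 [True])) (stacks (enc_unary n @ a) b c [] e f)
     (5 * n + 1) (stacks (False # a) b c (replicate n True) e f)"
proof -
  let ?S = "\<lambda>k. stacks (replicate k True @ False # a) b c (replicate (n - k) True) e f"
  have "runs (while_top 0 {True} (pop 0 @ emit 3 [True])) (?S n) (n * (2 + 3) + 1) (?S 0)"
  proof (rule runs_unary_loop[where r = "False # a"])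
    fix k assume k: "k < n"
    show "runs (emit 3 [True]) ((?S (Suc k))(0 := replicate k True @ False # a)) 2 (?S k)"
      unfolding stacks_update
      by (rule runs_cong, rule runs_emit_stacks) (simp_all add: replicate_Suc_diff[OF k])
  qed simp_all
  then show ?thesis by (simp add: enc_unary_def mult.commute)
qed

lemma runs_write_number:
  "runs (while_top 5 {True} (pop 5 @ emit 0 [True, True])) (stacks a b c d e (replicate n True))
     (7 * n + 1) (stacks (replicate (2 * n) True @ a) b c d e [])"
proof -
  let ?S = "\<lambda>k. stacks (replicate (2 * (n - k)) True @ a) b c d e (replicate k True)"
  have "runs (while_top 5 {True} (pop 5 @ emit 0 [True, True])) (?S n) (n * (4 + 3) + 1) (?S 0)"
  proof (rule runs_unary_loop[where r = "[]"])
    fix k assume k: "k < n"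
    show "runs (emit 0 [True, True]) ((?S (Suc k))(5 := replicate k True @ [])) 4 (?S k)"
      unfolding stacks_update
      by (rule runs_cong, rule runs_emit_stacks) (simp_all add: replicate_double_Suc_diff[OF k])
  qed simp_all
  then show ?thesis by (simp add: mult.commute)
qed

lemma runs_pour_stacks:
  "runs (pour 2 0) (stacks a b c d e f) (7 * length c + 1) (stacks (rev c @ a) b [] d e f)"
  "runs (pour 1 0) (stacks a b c d e f) (7 * length b + 1) (stacks (rev b @ a) [] c d e f)"
  using runs_pour[of 2 0 "stacks a b c d e f"] runs_pour[of 1 0 "stacks a b c d e f"] by simp_all

lemma enc_terms_butlast: "enc_terms ts = butlast (enc_terms ts) @ [False]"
  by (simp add: enc_terms_def enc_list_def)

lemma runs_reduction_code:
  fixes n ts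
  defines "w \<equiv> enc_unary n @ enc_terms ts"
  shows "runs reduction_code (stacks w [] [] [] [] []) (7000 * length w ^ 2 + 7000)
     (stacks (enc_unary (2 * end_index n ts + 1) @ enc_list enc_terms (reduced_forms n ts))
        [] [] [] [] [])"
proof -
  define J L where "J = end_index n ts" and "L = length w"
  let ?enc = "\<lambda>qs. concat (map (\<lambda>q. True # enc_terms q) qs)"
  define x y where "x = rev (?enc (map box_form (rev [0..<J]))) @ rev (?enc (product_forms n ts))"
    and "y = False # False # rev (butlast (enc_terms (value_form n ts))) @ [True]"
  define t where "t = 5 * n + 11 + (28 * J + 200) * length (enc_terms ts) + J * (56 * J + 153)"
  have first: "runs (while_top 0 {True} (pop 0 @ emit 3 [True]) @ pop 0 @
      emit 2 [True] @ while_top 0 {True} emit_term @ pop 0 @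
      while_top 3 {True} (pop 3 @ emit_box) @ emit 2 [False, False])
      (stacks w [] [] [] [] []) t (stacks [] x y [] [] (replicate J True))"
    unfolding w_def
    by (rule runs_cong, (rule runs_append runs_read_number runs_pop_input
        runs_terms[OF order_refl, where a = "[]", unfolded append_Nil2] runs_boxes runs_emit_stacks)+)
       (simp_all add: x_def y_def t_def J_def)
  \<comment> \<open>Stacks 1 and 2 start empty, so the time spent bounds their heights, and thereby
    the cost of pouring them.\<close>
  have len: "length x \<le> t" "length y \<le> t"
    using runs_length[OF first, of 1] runs_length[OF first, of 2] by simp_all
  have second: "runs (pour 2 0 @ pour 1 0 @
      emit 0 [False, True] @ while_top 5 {True} (pop 5 @ emit 0 [True, True]))
      (stacks [] x y [] [] (replicate J True)) (14 * t + 7 * J + 7)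
      (stacks (enc_unary (2 * J + 1) @ rev x @ rev y) [] [] [] [] [])"
    by (rule runs_cong, (rule runs_append runs_pour_stacks runs_emit_stacks runs_write_number)+)
       (use len in \<open>simp_all add: enc_unary_def replicate_app_Cons_same\<close>)
  have out: "rev x @ rev y = enc_list enc_terms (reduced_forms n ts)"
    using enc_terms_butlast[of "value_form n ts"]
    by (simp add: x_def y_def enc_list_def reduced_forms_def J_def)
  have "n \<le> L" "length (enc_terms ts) \<le> L" "J \<le> L"
    using end_index_le[of n ts] by (auto simp: L_def w_def J_def enc_unary_def)
  then have "t \<le> 5 * L + 11 + (28 * L + 200) * L + L * (56 * L + 153)"
    unfolding t_def by (intro add_mono mult_mono) auto
  also have "\<dots> = 84 * L ^ 2 + 358 * L + 11"
    by (simp add: power2_eq_square algebra_simps)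
  finally have "t \<le> 84 * L ^ 2 + 358 * L + 11" .
  moreover have "L \<le> L ^ 2" by (simp add: power2_eq_square)
  \<comment> \<open>The left side is at most \<open>1260 * L ^ 2 + 5377 * L + 172\<close>, hence at
    most \<open>6637 * L ^ 2 + 172\<close>.\<close>
  ultimately have time: "t + (14 * t + 7 * J + 7) \<le> 7000 * L ^ 2 + 7000"
    using \<open>J \<le> L\<close> by linarith
  have "runs reduction_code (stacks w [] [] [] [] []) (t + (14 * t + 7 * J + 7))
      (stacks (enc_unary (2 * J + 1) @ rev x @ rev y) [] [] [] [] [])"
    using runs_append[OF first second] by (simp add: reduction_code_def)
  then show ?thesis
    unfolding out J_def[symmetric] L_def[symmetric] by (rule runs_mono) (rule time)
qed

section \<open>Polynomials as lists of terms\<close>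

definition eval_terms :: "terms \<Rightarrow> (nat \<Rightarrow> real) \<Rightarrow> real" where
  "eval_terms ts x = (\<Sum>(vs, c) \<leftarrow> ts. of_rat c * prod_list (map x vs))"

lemma eval_terms_Nil [simp]: "eval_terms [] x = 0"
  by (simp add: eval_terms_def)

lemma eval_terms_Cons [simp]:
  "eval_terms ((vs, c) # ts) x = of_rat c * prod_list (map x vs) + eval_terms ts x"
  by (simp add: eval_terms_def)

lemma lookup_monom_of: "Poly_Mapping.lookup (monom_of vs) i = count (mset vs) i"
  by (induction vs) (auto simp: monom_of_def lookup_add lookup_single when_def)

lemma keys_monom_of: "Poly_Mapping.keys (monom_of vs) = set vs"
  by (auto simp: in_keys_iff lookup_monom_of simp flip: count_greater_zero_iff)

lemma monom_of_eq_iff: "monom_of us = monom_of vs \<longleftrightarrow> mset us = mset vs"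
  by (auto simp: poly_mapping_eq_iff fun_eq_iff lookup_monom_of multiset_eq_iff)

lemma monom_of_pair_eq_iff:
  "monom_of [a, b] = monom_of [c, d] \<longleftrightarrow> a = c \<and> b = d \<or> a = d \<and> b = c"
  by (auto simp: monom_of_eq_iff add_eq_conv_diff)

lemma monom_degree_monom_of: "monom_degree (monom_of vs) = length vs"
  using size_multiset_overloaded_eq[of "mset vs"]
  by (simp add: monom_degree_def keys_monom_of lookup_monom_of)

lemma prod_monom_of:
  fixes x :: "nat \<Rightarrow> real"
  shows "(\<Prod>i \<in> Poly_Mapping.keys (monom_of vs). x i ^ Poly_Mapping.lookup (monom_of vs) i) =
    prod_list (map x vs)"
  using image_prod_mset_multiplicity[of x "mset vs"]
  by (simp add: keys_monom_of lookup_monom_of flip: prod_mset_prod_list)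

lemma keys_lists_terms:
  assumes "lists_terms ts h"
  shows "Poly_Mapping.keys h = (\<lambda>(vs, c). monom_of vs) ` set ts"
proof -
  have "fst ` (\<lambda>(vs, c). (monom_of vs, c)) ` set ts =
      fst ` (\<lambda>m. (m, Poly_Mapping.lookup h m)) ` Poly_Mapping.keys h"
    using assms by (simp add: lists_terms_def)
  then show ?thesis by (simp add: image_image case_prod_unfold)
qed

lemma lists_terms_nonzero: "lists_terms ts h \<Longrightarrow> (vs, c) \<in> set ts \<Longrightarrow> c \<noteq> 0"
  unfolding lists_terms_def by (force simp: in_keys_iff)

lemma in_vars_lists_terms:
  "lists_terms ts h \<Longrightarrow> in_vars n h \<longleftrightarrow> (\<forall>(vs, c) \<in> set ts. set vs \<subseteq> {..<n})"
  by (fastforce simp: in_vars_def keys_lists_terms keys_monom_of)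

lemma quadratic_form_lists_terms:
  "lists_terms ts h \<Longrightarrow> quadratic_form h \<longleftrightarrow> (\<forall>(vs, c) \<in> set ts. length vs = 2)"
  by (fastforce simp: quadratic_form_def keys_lists_terms monom_degree_monom_of)

text \<open>Distinct monomials make the map from list entries to pairs of monomial and coefficient
  injective, so the sum over the list is the sum over the keys.\<close>

lemma poly_eval_lists_terms:
  assumes "lists_terms ts h"
  shows "poly_eval h x = eval_terms ts x"
proof -
  define G where "G = (\<lambda>(m, c). of_rat c *
    (\<Prod>i \<in> Poly_Mapping.keys m. x i ^ Poly_Mapping.lookup m i))"
  have dist: "distinct (map (\<lambda>(vs, c). monom_of vs) ts)"
    and img: "(\<lambda>(vs, c). (monom_of vs, c)) ` set ts =
       (\<lambda>m. (m, Poly_Mapping.lookup h m)) ` Poly_Mapping.keys h"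
    using assms by (auto simp: lists_terms_def)
  then have inj: "inj_on (\<lambda>(vs, c). (monom_of vs, c)) (set ts)"
    by (auto simp: distinct_map inj_on_def)
  have "poly_eval h x = sum G ((\<lambda>m. (m, Poly_Mapping.lookup h m)) ` Poly_Mapping.keys h)"
    by (subst sum.reindex) (auto simp: inj_on_def poly_eval_def G_def)
  also have "\<dots> = (\<Sum>p \<in> set ts. G (case p of (vs, c) \<Rightarrow> (monom_of vs, c)))"
    by (subst img[symmetric], subst sum.reindex[OF inj]) simp
  also have "\<dots> = (\<Sum>p \<leftarrow> ts. G (case p of (vs, c) \<Rightarrow> (monom_of vs, c)))"
    using dist by (simp add: distinct_map sum_list_distinct_conv_sum_set)
  also have "\<dots> = eval_terms ts x"
    by (simp add: eval_terms_def G_def case_prod_unfold prod_monom_of)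
  finally show ?thesis .
qed

text \<open>The machine writes lists, while an instance consists of polynomials; this supplies the
  polynomials.\<close>

lemma lists_terms_some_poly:
  assumes "distinct (map (\<lambda>(vs, c). monom_of vs) ts)" "\<forall>(vs, c) \<in> set ts. c \<noteq> 0"
  shows "\<exists>h. lists_terms ts h"
  using assms
proof (induction ts)
  case Nil
  have "lists_terms [] 0" by (simp add: lists_terms_def)
  then show ?case by blast
next
  case (Cons t ts)
  obtain vs c where t: "t = (vs, c)" by force
  obtain h where h: "lists_terms ts h" using Cons by auto
  let ?h = "Poly_Mapping.update (monom_of vs) c h"
  have c: "c \<noteq> 0" and new: "monom_of vs \<notin> Poly_Mapping.keys h"
    using Cons.prems keys_lists_terms[OF h] by (auto simp: t)
  have "(\<lambda>m. (m, Poly_Mapping.lookup ?h m)) ` Poly_Mapping.keys h =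
      (\<lambda>m. (m, Poly_Mapping.lookup h m)) ` Poly_Mapping.keys h"
    using new by (intro image_cong) (auto simp: lookup_update)
  then have "lists_terms (t # ts) ?h"
    using Cons.prems(1) h c by (simp add: t lists_terms_def keys_update lookup_update)
  then show ?case by blast
qed

section \<open>Correctness of the reduction\<close>

text \<open>What makes a list of terms the encoding of a form that is admissible in an instance of
  \<open>HQSF\<close> with \<open>m\<close> variables.\<close>

definition valid_form :: "nat \<Rightarrow> terms \<Rightarrow> bool" where
  "valid_form m q \<longleftrightarrow> distinct (map (\<lambda>(vs, c). monom_of vs) q) \<and>
     (\<forall>(vs, c) \<in> set q. length vs = 2 \<and> set vs \<subseteq> {..<m} \<and> c \<noteq> 0)"

lemma valid_chain_forms:
  assumes "\<forall>v \<in> set vs. 2 * v + 1 < m" "2 * (j + length vs) + 1 < m" "q \<in> set (chain_forms j vs)"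
  shows "valid_form m q"
  using assms
  by (induction j vs rule: chain_forms.induct)
     (auto simp: valid_form_def step_form_def monom_of_pair_eq_iff)

lemma valid_product_forms:
  assumes "\<forall>(vs, c) \<in> set ts. \<forall>v \<in> set vs. 2 * v + 1 < m" "2 * end_index j ts \<le> m"
    "q \<in> set (product_forms j ts)"
  shows "valid_form m q"
  using assms
proof (induction j ts rule: product_forms.induct)
  case (2 j vs c ts)
  have le: "Suc (j + length vs) \<le> end_index (Suc (j + length vs)) ts"
    by (rule end_index_ge)
  then have "2 * (j + length vs) + 1 < m"
    using "2.prems"(2) by simp
  then show ?case
    using 2 valid_chain_forms[of vs m j q]
    by (auto simp: valid_form_def start_form_def monom_of_pair_eq_iff)
qed simp

lemma value_form_index:
  "(vs, c) \<in> set (value_form j ts) \<Longrightarrow> \<exists>i. j \<le> i \<and> i < end_index j ts \<and> vs = [0, 2 * i + 1]"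
proof (induction j ts rule: value_form.induct)
  case (2 j us d ts)
  let ?j = "Suc (j + length us)"
  have le: "?j \<le> end_index ?j ts" by (rule end_index_ge)
  show ?case
  proof (cases "(vs, c) \<in> set (value_form ?j ts)")
    case True
    then obtain i where "?j \<le> i" "i < end_index ?j ts" "vs = [0, 2 * i + 1]"
      using "2.IH" by blast
    then show ?thesis by (intro exI[of _ i]) simp
  next
    case False
    then have "vs = [0, 2 * (j + length us) + 1]" using "2.prems" by simp
    then show ?thesis using le by (intro exI[of _ "j + length us"]) simp
  qed
qed simp

lemma value_form_coeff: "(vs, c) \<in> set (value_form j ts) \<Longrightarrow> c \<in> snd ` set ts"
  by (induction j ts rule: value_form.induct) force+

text \<open>Full products of later terms have larger numbers, so their variables differ, whatever
  the monomials of the input are.\<close>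

lemma distinct_value_form: "distinct (map (\<lambda>(vs, c). monom_of vs) (value_form j ts))"
proof (induction j ts rule: value_form.induct)
  case (2 j vs c ts)
  have "monom_of [0, 2 * (j + length vs) + 1] \<noteq> monom_of us"
    if "(us, d) \<in> set (value_form (Suc (j + length vs)) ts)" for us d
    using value_form_index[OF that] by (auto simp: monom_of_pair_eq_iff)
  with 2 show ?case by fastforce
qed simp

lemma valid_reduced_forms:
  assumes "\<forall>(vs, c) \<in> set ts. set vs \<subseteq> {..<n} \<and> c \<noteq> 0" "q \<in> set (reduced_forms n ts)"
  shows "valid_form (2 * end_index n ts + 1) q"
proof -
  have n: "n \<le> end_index n ts" by (rule end_index_ge)
  consider "q \<in> set (product_forms n ts)" | j where "q = box_form j" "j < end_index n ts"
    | "q = value_form n ts"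
    using assms(2) by (auto simp: reduced_forms_def)
  then show ?thesis
  proof cases
    case 1
    moreover have "\<forall>(vs, c) \<in> set ts. \<forall>v \<in> set vs. 2 * v + 1 < 2 * end_index n ts + 1"
      using assms(1) n by fastforce
    ultimately show ?thesis by (intro valid_product_forms) auto
  next
    case 2
    then show ?thesis
      by (auto simp: box_form_def valid_form_def monom_of_pair_eq_iff)
  next
    case 3
    have "c \<noteq> 0" if "(vs, c) \<in> set (value_form n ts)" for vs c
      using value_form_coeff[OF that] assms(1) by auto
    then show ?thesis
      using distinct_value_form value_form_index[of _ _ n ts] by (fastforce simp: 3 valid_form_def)
  qed
qed

section \<open>Values forced by the forms, and values satisfying them\<close>

lemma chain_forms_product:
  assumes "y 0 \<noteq> 0" "\<forall>q \<in> set (chain_forms j vs). eval_terms q y = 0"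
  shows "y (2 * (j + length vs) + 1) = y (2 * j + 1) * prod_list (map (\<lambda>v. y (2 * v + 1) / y 0) vs)"
  using assms
proof (induction j vs rule: chain_forms.induct)
  case (2 j v vs)
  then have "y (2 * Suc j + 1) = y (2 * j + 1) * (y (2 * v + 1) / y 0)"
    by (auto simp: step_form_def field_simps of_rat_minus eval_nat_numeral)
  with 2 show ?case by simp
qed simp

text \<open>Cancelling t in the start form makes the empty product equal to t, so each full product
  is t times the dehomogenized monomial; the factor t of the value form gives the second power. Both
  directions of the equivalence use this.\<close>

lemma product_forms_value:
  assumes "y 0 \<noteq> 0" "\<forall>q \<in> set (product_forms j ts). eval_terms q y = 0"
  shows "eval_terms (value_form j ts) y = (y 0)\<^sup>2 * eval_terms ts (\<lambda>i. y (2 * i + 1) / y 0)"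
  using assms
proof (induction j ts rule: product_forms.induct)
  case (2 j vs c ts)
  have "y (2 * j + 1) = y 0"
    using 2(2,3) by (auto simp: start_form_def of_rat_minus)
  moreover have "y (2 * (j + length vs) + 1) =
      y (2 * j + 1) * prod_list (map (\<lambda>v. y (2 * v + 1) / y 0) vs)"
    using 2(2,3) by (intro chain_forms_product) auto
  ultimately show ?case
    using 2 by (simp add: power2_eq_square algebra_simps)
qed simp

text \<open>Each quantity and its slack together contribute the square of t, and t itself
  contributes one more. This makes t nonzero on the sphere and, conversely, fixes the
  scaling.\<close>

lemma box_forms_norm:
  assumes "\<forall>j < m. eval_terms (box_form j) y = 0"
  shows "(\<Sum>i < 2 * m + 1. (y i)\<^sup>2) = (real m + 1) * (y 0)\<^sup>2"
  using assms
proof (induction m)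
  case (Suc m)
  have "(y (2 * m + 1))\<^sup>2 + (y (2 * m + 2))\<^sup>2 = (y 0)\<^sup>2"
    using Suc.prems by (auto simp: box_form_def of_rat_minus power2_eq_square dest: spec[of _ m])
  with Suc show ?case by (simp add: algebra_simps)
qed simp

text \<open>The values are extended one partial product at a time, and products of numbers in
  [-1, 1] stay there. As \<open>v \<le> j\<close>, no factor is overwritten. Every \<open>y\<close>
  with the given odd entries is covered, because t and the slacks are chosen later.\<close>

lemma chain_values_exist:
  fixes u :: "nat \<Rightarrow> real"
  assumes "\<forall>v \<in> set vs. v \<le> j" "\<forall>i \<le> j. \<bar>u i\<bar> \<le> 1"
  shows "\<exists>u'. (\<forall>i \<le> j. u' i = u i) \<and> (\<forall>i \<le> j + length vs. \<bar>u' i\<bar> \<le> 1) \<and>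
    (\<forall>y. (\<forall>i \<le> j + length vs. y (2 * i + 1) = y 0 * u' i) \<longrightarrow>
       (\<forall>q \<in> set (chain_forms j vs). eval_terms q y = 0))"
  using assms
proof (induction vs arbitrary: j u)
  case Nil
  then show ?case by auto
next
  case (Cons v vs)
  let ?u = "u(Suc j := u j * u v)"
  have "\<forall>i \<le> Suc j. \<bar>?u i\<bar> \<le> 1"
    using Cons.prems by (auto simp: abs_mult le_Suc_eq intro: mult_le_one)
  then obtain u' where u': "\<forall>i \<le> Suc j. u' i = ?u i" "\<forall>i \<le> Suc j + length vs. \<bar>u' i\<bar> \<le> 1"
    "\<And>y. \<forall>i \<le> Suc j + length vs. y (2 * i + 1) = y 0 * u' i \<Longrightarrow>
       \<forall>q \<in> set (chain_forms (Suc j) vs). eval_terms q y = 0"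
    using Cons.IH[of "Suc j" ?u] Cons.prems(1) by fastforce
  have "eval_terms (step_form j v) y = 0"
    if y: "\<forall>i \<le> j + length (v # vs). y (2 * i + 1) = y 0 * u' i" for y
  proof -
    have "y (2 * j + 1) = y 0 * u j" "y (2 * v + 1) = y 0 * u v" "y (2 * Suc j + 1) = y 0 * (u j * u v)"
      using y[rule_format, of j] y[rule_format, of v] y[rule_format, of "Suc j"] u'(1) Cons.prems(1)
      by auto
    then show ?thesis by (simp add: step_form_def of_rat_minus eval_nat_numeral)
  qed
  then show ?case
    using u' by (intro exI[of _ u']) auto
qed

lemma product_values_exist:
  fixes u :: "nat \<Rightarrow> real"
  assumes "\<forall>(vs, c) \<in> set ts. \<forall>v \<in> set vs. v < j" "\<forall>i < j. \<bar>u i\<bar> \<le> 1"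
  shows "\<exists>u'. (\<forall>i < j. u' i = u i) \<and> (\<forall>i < end_index j ts. \<bar>u' i\<bar> \<le> 1) \<and>
    (\<forall>y. (\<forall>i < end_index j ts. y (2 * i + 1) = y 0 * u' i) \<longrightarrow>
       (\<forall>q \<in> set (product_forms j ts). eval_terms q y = 0))"
  using assms
proof (induction j ts arbitrary: u rule: product_forms.induct)
  case (1 j)
  then show ?case by auto
next
  case (2 j vs c ts)
  let ?j = "Suc (j + length vs)"
  \<comment> \<open>The value 1 at \<open>j\<close> is the empty product that opens the
    term.\<close>
  have "\<forall>v \<in> set vs. v \<le> j" "\<forall>i \<le> j. \<bar>(u(j := 1)) i\<bar> \<le> 1"
    using "2.prems" by (auto intro: less_imp_le)
  from chain_values_exist[OF this] obtain u1 where u1: "\<forall>i \<le> j. u1 i = (u(j := 1)) i"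
    "\<forall>i \<le> j + length vs. \<bar>u1 i\<bar> \<le> 1"
    "\<And>y. \<forall>i \<le> j + length vs. y (2 * i + 1) = y 0 * u1 i \<Longrightarrow>
       \<forall>q \<in> set (chain_forms j vs). eval_terms q y = 0" by blast
  have "\<forall>(vs, c) \<in> set ts. \<forall>v \<in> set vs. v < ?j" "\<forall>i < ?j. \<bar>u1 i\<bar> \<le> 1"
    using "2.prems"(1) u1(2) by fastforce+
  from "2.IH"[OF this] obtain u' where u': "\<forall>i < ?j. u' i = u1 i"
    "\<forall>i < end_index ?j ts. \<bar>u' i\<bar> \<le> 1"
    "\<And>y. \<forall>i < end_index ?j ts. y (2 * i + 1) = y 0 * u' i \<Longrightarrow>
       \<forall>q \<in> set (product_forms ?j ts). eval_terms q y = 0" by blast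
  have le: "?j \<le> end_index ?j ts" by (rule end_index_ge)
  have "eval_terms q y = 0"
    if y: "\<forall>i < end_index ?j ts. y (2 * i + 1) = y 0 * u' i"
      and q: "q \<in> set (product_forms j ((vs, c) # ts))" for y q
  proof -
    have "y (2 * i + 1) = y 0 * u1 i" if "i \<le> j + length vs" for i
      using y that le u'(1) by auto
    moreover from this[of j] have "eval_terms (start_form j) y = 0"
      using u1(1) by (simp add: start_form_def of_rat_minus)
    ultimately show ?thesis using q u1(3) u'(3)[OF y] by auto
  qed
  moreover have "\<forall>i < j. u' i = u i"
    using u'(1) u1(1) by auto
  ultimately show ?case
    using u'(2) by (intro exI[of _ u']) auto
qed

section \<open>The two directions of the equivalence\<close>

lemma eval_terms_cong:
  assumes "\<forall>(vs, c) \<in> set ts. set vs \<subseteq> {..<n}" "\<forall>i < n. x i = y i"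
  shows "eval_terms ts x = eval_terms ts y"
proof -
  have "prod_list (map x vs) = prod_list (map y vs)" if "(vs, c) \<in> set ts" for vs c
    using that assms by (intro arg_cong[where f = prod_list] map_cong) fastforce+
  then show ?thesis
    unfolding eval_terms_def by (intro arg_cong[where f = sum_list] map_cong) auto
qed

lemma sphere_zero_imp_box_zero:
  assumes norm: "(\<Sum>i < 2 * end_index n ts + 1. (y i)\<^sup>2) = 1"
    and zero: "\<forall>q \<in> set (reduced_forms n ts). eval_terms q y = 0"
  shows "\<exists>x. (\<forall>i < n. x i \<in> {- 1..1}) \<and> eval_terms ts x = 0"
proof -
  have box: "\<forall>j < end_index n ts. eval_terms (box_form j) y = 0"
    and prods: "\<forall>q \<in> set (product_forms n ts). eval_terms q y = 0"
    and val: "eval_terms (value_form n ts) y = 0"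
    using zero by (auto simp: reduced_forms_def)
  \<comment> \<open>With \<open>y 0 = 0\<close>, the sum of squares would be 0 instead of 1.\<close>
  have t: "y 0 \<noteq> 0"
    using box_forms_norm[OF box] norm by auto
  define x where "x = (\<lambda>i. y (2 * i + 1) / y 0)"
  have "x i \<in> {- 1..1}" if "i < n" for i
  proof -
    have "i < end_index n ts" using that end_index_ge[of n ts] by simp
    then have "(y (2 * i + 1))\<^sup>2 + (y (2 * i + 2))\<^sup>2 = (y 0)\<^sup>2"
      using box by (auto simp: box_form_def of_rat_minus power2_eq_square)
    then have "(y (2 * i + 1))\<^sup>2 \<le> (y 0)\<^sup>2"
      using zero_le_power2[of "y (2 * i + 2)"] by linarith
    then have "(x i)\<^sup>2 \<le> 1"
      using t by (simp add: x_def power_divide)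
    then show ?thesis by (simp add: abs_square_le_1 abs_le_iff)
  qed
  moreover have "eval_terms ts x = 0"
    using product_forms_value[OF t prods] val t by (simp add: x_def)
  ultimately show ?thesis by blast
qed

lemma box_zero_imp_sphere_zero:
  assumes vars: "\<forall>(vs, c) \<in> set ts. set vs \<subseteq> {..<n}"
    and x: "\<forall>i < n. x i \<in> {- 1..1}" "eval_terms ts x = 0"
  shows "\<exists>y. (\<Sum>i < 2 * end_index n ts + 1. (y i)\<^sup>2) = 1 \<and>
    (\<forall>q \<in> set (reduced_forms n ts). eval_terms q y = 0)"
proof -
  define J where "J = end_index n ts"
  have "\<forall>(vs, c) \<in> set ts. \<forall>v \<in> set vs. v < n" "\<forall>i < n. \<bar>x i\<bar> \<le> 1"
    using vars x(1) by (fastforce simp: abs_le_iff)+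
  from product_values_exist[OF this] obtain u where u: "\<forall>i < n. u i = x i"
    "\<forall>i < J. \<bar>u i\<bar> \<le> 1"
    "\<And>y. \<forall>i < J. y (2 * i + 1) = y 0 * u i \<Longrightarrow>
       \<forall>q \<in> set (product_forms n ts). eval_terms q y = 0"
    unfolding J_def by blast
  \<comment> \<open>By \<open>box_forms_norm\<close>, this scale puts the point on the unit
    sphere.\<close>
  define a where "a = 1 / sqrt (real J + 1)"
  \<comment> \<open>At \<open>k = 2 * j + 2\<close> the quotient \<open>k div 2\<close> is
    \<open>j + 1\<close>, whence the \<open>- 1\<close>. The root is the slack value that solves the
    box form; it is real for \<open>j < J\<close>, as \<open>u j\<close> lies in [-1, 1].\<close>
  define y where "y = (\<lambda>k. if k = 0 then a else if odd k then a * u (k div 2)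
     else a * sqrt (1 - (u (k div 2 - 1))\<^sup>2))"
  have a: "a \<noteq> 0" "(real J + 1) * a\<^sup>2 = 1"
    by (simp_all add: a_def power_divide)
  have y: "y 0 = a" "\<And>j. y (2 * j + 1) = a * u j" "\<And>j. y (2 * j + 2) = a * sqrt (1 - (u j)\<^sup>2)"
    by (auto simp: y_def)
  have box: "\<forall>j < J. eval_terms (box_form j) y = 0"
  proof (intro allI impI)
    fix j assume "j < J"
    then have "(u j)\<^sup>2 \<le> 1" using u(2) by (simp add: abs_square_le_1)
    then show "eval_terms (box_form j) y = 0"
      using y(2,3)[of j] y(1)
      by (simp add: box_form_def of_rat_minus algebra_simps flip: power2_eq_square)
  qed
  have prods: "\<forall>q \<in> set (product_forms n ts). eval_terms q y = 0"
    by (rule u(3)) (simp add: y[simplified])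
  have "eval_terms (value_form n ts) y = a\<^sup>2 * eval_terms ts u"
    using product_forms_value[OF _ prods] a(1) by (simp add: y[simplified])
  also have "eval_terms ts u = eval_terms ts x"
    using eval_terms_cong[OF vars, of u x] u(1) by simp
  finally have "eval_terms (value_form n ts) y = 0" using x(2) by simp
  moreover have "(\<Sum>i < 2 * J + 1. (y i)\<^sup>2) = 1"
    using box_forms_norm[OF box] a(2) y(1) by simp
  ultimately show ?thesis
    using prods box by (intro exI[of _ y]) (auto simp: reduced_forms_def J_def)
qed

theorem mainTheorem2:
  shows "polytime_reducible BQ4E HQSF"
proof -
  let ?D = "{w. \<exists>I \<in> instances BQ4E. encodes BQ4E w I}"
  let ?good = "\<lambda>w v. tm_computes_within (machine reduction_code) w v (7000 * length w ^ 2 + 7000) \<and>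
    (\<forall>I \<in> instances BQ4E. encodes BQ4E w I \<longrightarrow>
      (\<exists>J \<in> instances HQSF. encodes HQSF v J \<and> (I \<in> yes_instances BQ4E \<longleftrightarrow> J \<in> yes_instances HQSF)))"
  have "\<exists>v. ?good w v" if w: "w \<in> ?D" for w
  proof -
    obtain n h ts where ts: "lists_terms ts h" "in_vars n h" "w = enc_unary n @ enc_terms ts"
      and I: "encodes BQ4E w (n, h)"
      using w by (auto simp: BQ4E_def)
    define N where "N = 2 * end_index n ts + 1"
    define v where "v = enc_unary N @ enc_list enc_terms (reduced_forms n ts)"
    have vars: "\<forall>(vs, c) \<in> set ts. set vs \<subseteq> {..<n}"
      using ts in_vars_lists_terms by blast
    have valid: "\<forall>q \<in> set (reduced_forms n ts). valid_form N q"
      unfolding N_def using vars lists_terms_nonzero[OF ts(1)]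
      by (intro ballI valid_reduced_forms) auto
    then have "\<forall>q \<in> set (reduced_forms n ts). \<exists>p. lists_terms q p"
      by (intro ballI lists_terms_some_poly) (fastforce simp: valid_form_def)+
    then obtain P where P: "\<And>q. q \<in> set (reduced_forms n ts) \<Longrightarrow> lists_terms q (P q)"
      by metis
    define J where "J = (N, map P (reduced_forms n ts))"
    have "runs reduction_code ((\<lambda>_. [])(0 := w)) (7000 * length w ^ 2 + 7000) (stacks v [] [] [] [] [])"
    proof -
      have "(\<lambda>_. [])(0 := w) = stacks w [] [] [] [] []"
        by (auto simp: stacks_def)
      then show ?thesis
        using runs_reduction_code[of n ts] by (simp only: ts(3) v_def N_def)
    qed
    from runs_computes[OF this]
    have "tm_computes_within (machine reduction_code) w v (7000 * length w ^ 2 + 7000)"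
      by simp
    moreover have "J \<in> instances HQSF"
      using valid P in_vars_lists_terms quadratic_form_lists_terms
      by (fastforce simp: HQSF_def J_def valid_form_def)
    moreover have "encodes HQSF v J"
      using P by (auto simp: HQSF_def J_def v_def list_all2_conv_all_nth)
    moreover have "(n, h) \<in> yes_instances BQ4E \<longleftrightarrow> J \<in> yes_instances HQSF"
    proof -
      have "J \<in> yes_instances HQSF \<longleftrightarrow> (\<exists>y. (\<Sum>i < N. (y i)\<^sup>2) = 1 \<and>
          (\<forall>q \<in> set (reduced_forms n ts). eval_terms q y = 0))"
        by (simp add: HQSF_def J_def L2_set_def sum_nonneg poly_eval_lists_terms[OF P])
      moreover have "(n, h) \<in> yes_instances BQ4E \<longleftrightarrow>
          (\<exists>x. (\<forall>i < n. x i \<in> {- 1..1}) \<and> eval_terms ts x = 0)"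
        by (simp add: BQ4E_def poly_eval_lists_terms[OF ts(1)])
      ultimately show ?thesis
        unfolding N_def using sphere_zero_imp_box_zero box_zero_imp_sphere_zero[OF vars] by metis
    qed
    \<comment> \<open>The word determines the instance, so one output serves every instance that the
      word encodes.\<close>
    moreover have "I' = (n, h)" if "encodes BQ4E w I'" for I'
      using BQ4E_encoding_unambiguous[OF that I] .
    ultimately show ?thesis by blast
  qed
  then have "\<forall>w \<in> ?D. \<exists>v. ?good w v" by blast
  \<comment> \<open>The machine in \<open>?good\<close> is the same for all words, so it computes
    the chosen \<open>f\<close> on \<open>?D\<close>; elsewhere \<open>f\<close> is
    arbitrary.\<close>
  from bchoice[OF this] obtain f where f: "\<forall>w \<in> ?D. ?good w (f w)" ..
  have "polytime_computable_on ?D f"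
    unfolding polytime_computable_on_def using tm_wf_machine f by blast
  moreover have "\<forall>I \<in> instances BQ4E. \<forall>w. encodes BQ4E w I \<longrightarrow>
      (\<exists>J \<in> instances HQSF. encodes HQSF (f w) J \<and>
         (I \<in> yes_instances BQ4E \<longleftrightarrow> J \<in> yes_instances HQSF))"
    using f by blast
  ultimately show ?thesis
    unfolding polytime_reducible_def by blast
qed

end
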